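(* Let $(G_n)$ be a sequence, indexed by an infinite set of positive integers $n$, of connected $k$-regular simple graphs ($k\ge 2$), with $G_n$ having $n$ vertices. Let $c>0$ be the parameter of the first scheme. It need not be a constant: $c=c_n$ may grow or decay with $n$, provided that for some fixed $\alpha\in(0,1)$ and all sufficiently large $n$ in the index set $$n\ \ge\ \max\left\{\exp\left(\tfrac{10}{c}\right),\ \left(\tfrac{40c}{\alpha e}\right)^{1/(1-\alpha)}\right\},$$ where, if $c\log n$ is an integer for every $n$, the term $\exp(10/c)$ may be replaced by $\exp(1/c)$. (Any constant $c>0$ satisfies this.) Run the first scheme on $G_n$ with period $\tau=\lfloor c\log n\rfloor$, and let $T_1$ be its first restart time. Assume that $$\Pr\left(T_1<\lfloor c\log n\rfloor\right)\le 0.1 .$$ Then the maximum load achieved by the scheme is less than $\log_2\log n+\Theta(1)$ with high probability. That is, there is a constant $K$ such that, with probability tending to $1$ as $n\to\infty$, the loads after all $n$ balls have been placed satisfy $$\max_{v}Q_v(n)< \log_2\log n+K .$$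
   Context: All logarithms without base are natural. The first scheme on a connected $k$-regular simple graph $G=(V,E)$ with $|V|=n$ and integer period $\tau\ge1$: bins are the vertices of $G$. For each vertex $i$ fix a strict ordering of its neighbour set $N(i)$. A directed edge is an ordered pair $(j,i)$ of adjacent vertices; its end vertex is $i$. For a directed edge $e=(j,i)$ and $l\in\{1,\dots,k-1\}$ let $T(e,l)=(i,i')$, where $i'$ is the $l$-th ranked element of $N(i)\setminus\{j\}$. Let $D_1(t),D_2(t)$ ($t\ge1$) be i.i.d. uniform on $\{1,\dots,k-1\}$ and $R_1(t),R_2(t)$ ($t\ge0$) be i.i.d. uniform random directed edges, all mutually independent. Define directed edges $\Psi_1(t),\Psi_2(t)$, a visited set $M(t)\subseteq V$ and a counter $C(t)$ as follows. At time $0$: $\Psi_a(0)=R_a(0)$ for $a=1,2$, $M(0)$ is the set of end vertices of $\Psi_1(0),\Psi_2(0)$, and $C(0)=0$. For $t\ge1$: let $J(t)=1$ if the end vertex of $T(\Psi_a(t-1),D_a(t))$ lies in $M(t-1)$ for some $a\in\{1,2\}$, or if $C(t-1)=\tau-1$; otherwise $J(t)=0$. If $J(t)=0$, set $\Psi_a(t)=T(\Psi_a(t-1),D_a(t))$ for $a=1,2$, let $M(t)$ be $M(t-1)$ together with the end vertices of $\Psi_1(t),\Psi_2(t)$, and $C(t)=C(t-1)+1$. If $J(t)=1$ (a restart), set $\Psi_a(t)=R_a(t)$ for $a=1,2$, let $M(t)$ be the set of end vertices of $\Psi_1(t),\Psi_2(t)$, and $C(t)=0$. The walker position $W_a(t)$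 is the end vertex of $\Psi_a(t)$. The first restart time $T_1$ is the smallest $t\ge1$ with $J(t)=1$. Loads: $Q_v(0)=0$ for all $v\in V$. At each time $t=0,1,\dots,n-1$ one ball is added to whichever of the bins $W_1(t),W_2(t)$ has smaller load $Q_v(t)$, ties being broken by an arbitrary non-random rule; this gives $Q(t+1)$. *)

theory Defs
  imports "HOL-Probability.Probability" "Graph_Theory.Graph_Theory"
begin

text \<open>
  A simple graph is a symmetric, loop-free digraph without parallel arcs (locale \<^locale>\<open>pair_graph\<close>),
  so that \<open>parcs G\<close> is exactly the set of directed edges: ordered pairs \<open>(j, i)\<close> of adjacent
  vertices, with end vertex \<open>snd\<close>.
\<close>

definition neighbours :: "'v pair_pre_digraph \<Rightarrow> 'v \<Rightarrow> 'v set" where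
  "neighbours G i = {j. (i, j) \<in> parcs G}"

definition connected_regular_graph :: "nat \<Rightarrow> 'v pair_pre_digraph \<Rightarrow> bool" where
  "connected_regular_graph k G \<longleftrightarrow>
     pair_graph G \<and> Digraph_Component.connected (with_proj G) \<and>
     (\<forall>v \<in> pverts G. card (neighbours G v) = k)"

text \<open>The \<open>l\<close>-th smallest element of \<open>S\<close> with respect to the strict order \<open>r\<close>, counting from 1.\<close>

definition ranked :: "'v rel \<Rightarrow> 'v set \<Rightarrow> nat \<Rightarrow> 'v" where
  "ranked r S l = (THE x. x \<in> S \<and> card {y \<in> S. (y, x) \<in> r} + 1 = l)"

text \<open>\<open>ord i\<close> is the chosen strict order on the neighbours of \<open>i\<close>.\<close>

definition next_edge ::
  "'v pair_pre_digraph \<Rightarrow> ('v \<Rightarrow> 'v rel) \<Rightarrow> 'v \<times> 'v \<Rightarrow> nat \<Rightarrow> 'v \<times> 'v" where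
  "next_edge G ord e l = (case e of (j, i) \<Rightarrow> (i, ranked (ord i) (neighbours G i - {j}) l))"

text \<open>The randomness \<open>(D\<^sub>1(t), D\<^sub>2(t), R\<^sub>1(t), R\<^sub>2(t))\<close> of one time step.\<close>

type_synonym 'v seed = "nat \<times> nat \<times> ('v \<times> 'v) \<times> ('v \<times> 'v)"

record 'v config =
  psi1 :: "'v \<times> 'v"
  psi2 :: "'v \<times> 'v"
  visited :: "'v set"
  counter :: nat

definition start_config :: "'v \<times> 'v \<Rightarrow> 'v \<times> 'v \<Rightarrow> 'v config" where
  "start_config r1 r2 = \<lparr>psi1 = r1, psi2 = r2, visited = {snd r1, snd r2}, counter = 0\<rparr>"

definition must_restart ::
  "'v pair_pre_digraph \<Rightarrow> ('v \<Rightarrow> 'v rel) \<Rightarrow> nat \<Rightarrow> 'v config \<Rightarrow> nat \<Rightarrow> nat \<Rightarrow> bool" where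
  "must_restart G ord \<tau> s d1 d2 \<longleftrightarrow>
     snd (next_edge G ord (psi1 s) d1) \<in> visited s \<or>
     snd (next_edge G ord (psi2 s) d2) \<in> visited s \<or>
     counter s + 1 = \<tau>"

definition step ::
  "'v pair_pre_digraph \<Rightarrow> ('v \<Rightarrow> 'v rel) \<Rightarrow> nat \<Rightarrow> 'v config \<Rightarrow> 'v seed \<Rightarrow> 'v config" where
  "step G ord \<tau> s x = (case x of (d1, d2, r1, r2) \<Rightarrow>
     if must_restart G ord \<tau> s d1 d2 then start_config r1 r2
     else (let e1 = next_edge G ord (psi1 s) d1; e2 = next_edge G ord (psi2 s) d2
           in \<lparr>psi1 = e1, psi2 = e2, visited = visited s \<union> {snd e1, snd e2},
               counter = counter s + 1\<rparr>))"

primrec config_at ::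
  "'v pair_pre_digraph \<Rightarrow> ('v \<Rightarrow> 'v rel) \<Rightarrow> nat \<Rightarrow> (nat \<Rightarrow> 'v seed) \<Rightarrow> nat \<Rightarrow> 'v config" where
  "config_at G ord \<tau> \<omega> 0 = (case \<omega> 0 of (d1, d2, r1, r2) \<Rightarrow> start_config r1 r2)"
| "config_at G ord \<tau> \<omega> (Suc t) = step G ord \<tau> (config_at G ord \<tau> \<omega> t) (\<omega> (Suc t))"

definition restart_at ::
  "'v pair_pre_digraph \<Rightarrow> ('v \<Rightarrow> 'v rel) \<Rightarrow> nat \<Rightarrow> (nat \<Rightarrow> 'v seed) \<Rightarrow> nat \<Rightarrow> bool" where
  "restart_at G ord \<tau> \<omega> t \<longleftrightarrow>
     (case \<omega> t of (d1, d2, r1, r2) \<Rightarrow> must_restart G ord \<tau> (config_at G ord \<tau> \<omega> (t - 1)) d1 d2)"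

text \<open>For \<open>\<tau> \<ge> 1\<close> the counter forces a restart by time \<open>\<tau>\<close>, so the minimum below exists.\<close>

definition first_restart ::
  "'v pair_pre_digraph \<Rightarrow> ('v \<Rightarrow> 'v rel) \<Rightarrow> nat \<Rightarrow> (nat \<Rightarrow> 'v seed) \<Rightarrow> nat" where
  "first_restart G ord \<tau> \<omega> = (LEAST t. t \<ge> 1 \<and> restart_at G ord \<tau> \<omega> t)"

text \<open>
  The tie-breaking rule \<open>tie\<close> is an arbitrary deterministic function of the history
  of configurations up to the current time (hence of the time, the walker positions and the loads);
  \<open>True\<close> selects the first walker's bin.
\<close>

primrec load ::
  "'v pair_pre_digraph \<Rightarrow> ('v \<Rightarrow> 'v rel) \<Rightarrow> nat \<Rightarrow> ('v config list \<Rightarrow> bool) \<Rightarrow>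
   (nat \<Rightarrow> 'v seed) \<Rightarrow> nat \<Rightarrow> 'v \<Rightarrow> nat" where
  "load G ord \<tau> tie \<omega> 0 = (\<lambda>v. 0)"
| "load G ord \<tau> tie \<omega> (Suc t) =
     (let Q = load G ord \<tau> tie \<omega> t;
          w1 = snd (psi1 (config_at G ord \<tau> \<omega> t));
          w2 = snd (psi2 (config_at G ord \<tau> \<omega> t));
          b = (if Q w1 < Q w2 then w1
               else if Q w2 < Q w1 then w2
               else if tie (map (config_at G ord \<tau> \<omega>) [0..<Suc t]) then w1 else w2)
      in Q(b := Q b + 1))"

definition max_load ::
  "'v pair_pre_digraph \<Rightarrow> ('v \<Rightarrow> 'v rel) \<Rightarrow> nat \<Rightarrow> ('v config list \<Rightarrow> bool) \<Rightarrow>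
   (nat \<Rightarrow> 'v seed) \<Rightarrow> nat" where
  "max_load G ord \<tau> tie \<omega> = Max (load G ord \<tau> tie \<omega> (card (pverts G)) ` pverts G)"

text \<open>
  The canonical probability space carrying all \<open>D\<^sub>a(t)\<close> and \<open>R\<^sub>a(t)\<close> as mutually independent
  uniform variables; \<open>D\<^sub>a(0)\<close> is never used.
\<close>

definition seed_space :: "nat \<Rightarrow> 'v pair_pre_digraph \<Rightarrow> (nat \<Rightarrow> 'v seed) measure" where
  "seed_space k G =
     (\<Pi>\<^sub>M t\<in>UNIV. uniform_count_measure {1..k - 1} \<Otimes>\<^sub>M uniform_count_measure {1..k - 1} \<Otimes>\<^sub>M
                   uniform_count_measure (parcs G) \<Otimes>\<^sub>M uniform_count_measure (parcs G))"

definition period :: "real \<Rightarrow> nat \<Rightarrow> nat" where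
  "period c n = nat \<lfloor>c * ln (real n)\<rfloor>"

end

(*
The layered induction for balanced allocations, run over epochs. No vertex is visited at two
times of one epoch, so the walkers see the loads from its start; a ball can only land on a bin of load
at least h when both walkers stand in the set B of such bins. The non-backtracking walk is stationary,
so an epoch has on average at most tau p^2 such hits when |B| <= p n, while it lasts its full period with
probability at least 0.9. Hence the product over the epochs of (1 + a hits - beta [full epoch]) is a
supermartingale as soon as a tau p^2 <= 0.9 beta. At most n / tau epochs are full, so the charge beta
costs only a bounded power of 1 - beta, however many short epochs there are, and Markov's inequality
bounds the total number of hits.

With a = 1/tau the fraction p of heavy bins becomes 16 p^2 with an exponentially small error, which
is repeated about log2 (ln n) times, until p is a negative power of n. Then the error terms are
too large for this choice, and a of order 1/(p^2 n) takes p to p^(3/2) at the price of an error 16 sqrt p;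
a bounded number of these steps brings p below 1/n.
*)

theory Submission
  imports Defs "HOL-Real_Asymp.Real_Asymp"
begin

section \<open>Averages over finite sets and finite prefixes of product spaces\<close>

text \<open>The law of a walker that has survived so far without a restart is not uniform. Hits are
  therefore bounded by those of a walk that ignores restarts, which only adds nonnegative terms,
  while the chance of a full epoch is kept exact. In the first regime the charge is \<beta> = 2 p^2.
  Over at most 2 n / \<tau> full epochs it costs a factor of at most 2^(8 p^2 n / \<tau>), while 16
  p^2 n hits gain 2^(16 p^2 n / \<tau>); this is the origin of the 16. Writing p = 2^(-2^i) / 16
  turns the step from p to 16 p^2 into one from i to i + 1, and i = 0 is p = 1/32: at most n/32 bins
  can hold 32 of the n balls. The resulting error 2^(-8 p^2 n / \<tau>) is small only while p^2 n /
  \<tau> is large. The growth condition on c gives n / \<tau> at least n^(\<alpha>/2), so p may fall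
  to about n^(-\<alpha>/8). Below that no concentration is used: about p^2 n hits are expected, so
  by Markov p^(3/2) n hits have probability of order sqrt p, which is already a negative power of n.
  The number j of such rounds depends on \<alpha> alone, and 32 + j is the additive constant of the
  theorem.\<close>

definition avg :: "'a set \<Rightarrow> ('a \<Rightarrow> real) \<Rightarrow> real" where
  "avg A f = (\<Sum>x\<in>A. f x) / real (card A)"

lemma avg_mono: "(\<And>x. x \<in> A \<Longrightarrow> f x \<le> g x) \<Longrightarrow> avg A f \<le> avg A g"
  unfolding avg_def by (intro divide_right_mono sum_mono) auto

lemma avg_add: "avg A (\<lambda>x. f x + g x) = avg A f + avg A g"
  by (simp add: avg_def sum.distrib add_divide_distrib)

lemma avg_diff: "avg A (\<lambda>x. f x - g x) = avg A f - avg A g"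
  by (simp add: avg_def sum_subtractf diff_divide_distrib)

lemma avg_cmult: "avg A (\<lambda>x. c * f x) = c * avg A f"
  by (simp add: avg_def sum_distrib_left)

lemma avg_const: "finite A \<Longrightarrow> A \<noteq> {} \<Longrightarrow> avg A (\<lambda>x. c) = c"
  by (simp add: avg_def)

lemma avg_nonneg: "(\<And>x. x \<in> A \<Longrightarrow> 0 \<le> f x) \<Longrightarrow> 0 \<le> avg A f"
  by (simp add: avg_def sum_nonneg)

lemma avg_Times: "avg (A \<times> B) f = avg A (\<lambda>a. avg B (\<lambda>b. f (a, b)))"
  by (simp add: avg_def sum.cartesian_product card_cartesian_product sum_divide_distrib[symmetric] mult.commute)

lemma avg_commute: "avg A (\<lambda>a. avg B (\<lambda>b. f a b)) = avg B (\<lambda>b. avg A (\<lambda>a. f a b))"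
  unfolding avg_def by (simp add: sum_divide_distrib[symmetric] sum.swap[of _ A] mult.commute)

abbreviation seqs :: "'a set \<Rightarrow> nat \<Rightarrow> (nat \<Rightarrow> 'a) set" where
  "seqs X m \<equiv> PiE {..<m} (\<lambda>_. X)"

lemma avg_seqs_Suc:
  "avg (seqs X (Suc m)) F = avg (seqs X m) (\<lambda>w. avg X (\<lambda>x. F (w(m := x))))"
proof -
  have inj: "inj_on (\<lambda>(y, g). g(m := y)) (X \<times> seqs X m)"
    by (rule inj_combinator) simp
  have eq: "seqs X (Suc m) = (\<lambda>(y, g). g(m := y)) ` (X \<times> seqs X m)"
    unfolding lessThan_Suc by (rule PiE_insert_eq)
  have "avg (seqs X (Suc m)) F = avg (X \<times> seqs X m) (\<lambda>z. F (case z of (y, g) \<Rightarrow> g(m := y)))"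
    unfolding avg_def eq sum.reindex[OF inj] card_image[OF inj] by (simp add: o_def)
  also have "\<dots> = avg X (\<lambda>x. avg (seqs X m) (\<lambda>w. F (w(m := x))))"
    by (simp add: avg_Times)
  also have "\<dots> = avg (seqs X m) (\<lambda>w. avg X (\<lambda>x. F (w(m := x))))"
    by (rule avg_commute)
  finally show ?thesis .
qed

text \<open>Averaging over the coordinate \<open>t\<close> is the conditional expectation given the
  earlier ones, so the process needs no filtration. The final argument is the empty sequence, the
  only element of \<open>seqs X 0\<close>.\<close>

lemma avg_supermartingale:
  assumes step: "\<And>t w. t < m \<Longrightarrow> w \<in> seqs X t \<Longrightarrow> avg X (\<lambda>x. \<Phi> (Suc t) (w(t := x))) \<le> \<Phi> t w"
  shows "avg (seqs X m) (\<Phi> m) \<le> \<Phi> 0 (\<lambda>_. undefined)"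
  using step
proof (induction m)
  case 0
  show ?case by (simp add: avg_def)
next
  case (Suc m)
  have "avg (seqs X (Suc m)) (\<Phi> (Suc m)) \<le> avg (seqs X m) (\<Phi> m)"
    unfolding avg_seqs_Suc by (intro avg_mono Suc.prems) auto
  also have "\<dots> \<le> \<Phi> 0 (\<lambda>_. undefined)"
    by (intro Suc.IH Suc.prems) auto
  finally show ?case .
qed

lemma avg_markov:
  assumes "finite A" "\<And>x. x \<in> A \<Longrightarrow> 0 \<le> f x" "avg A f \<le> 1" "0 < c"
    and "\<And>x. x \<in> A \<Longrightarrow> P x \<Longrightarrow> c \<le> f x"
  shows "avg A (\<lambda>x. of_bool (P x)) \<le> 1 / c"
proof -
  have "c * avg A (\<lambda>x. of_bool (P x)) \<le> avg A f"
    unfolding avg_cmult[symmetric] by (rule avg_mono) (use assms in auto)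
  with assms show ?thesis by (simp add: field_simps)
qed

section \<open>Uniform measures on finite products, and events fixed by finitely many
  coordinates\<close>

lemma pair_uniform_count_measure:
  assumes "finite A" "finite B"
  shows "uniform_count_measure A \<Otimes>\<^sub>M uniform_count_measure B = uniform_count_measure (A \<times> B)"
proof (cases "A = {} \<or> B = {}")
  case True
  then have "space (uniform_count_measure A \<Otimes>\<^sub>M uniform_count_measure B) = {}"
    by (auto simp: space_pair_measure space_uniform_count_measure)
  moreover have "space (uniform_count_measure (A \<times> B)) = {}"
    using True by (auto simp: space_uniform_count_measure)
  ultimately show ?thesis
    by (metis space_empty)
next
  case False
  interpret A: prob_space "uniform_count_measure A"
    using False assms by (intro prob_space_uniform_count_measure) auto
  interpret B: prob_space "uniform_count_measure B"
    using False assms by (intro prob_space_uniform_count_measure) auto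
  let ?P = "uniform_count_measure A \<Otimes>\<^sub>M uniform_count_measure B"
  have single: "{z} \<in> sets ?P" if "z \<in> A \<times> B" for z
  proof -
    have "{fst z} \<times> {snd z} \<in> sets ?P"
      using that by (intro pair_measureI) (auto simp: sets_uniform_count_measure)
    then show ?thesis by simp
  qed
  have sets: "sets ?P = Pow (A \<times> B)"
  proof
    show "sets ?P \<subseteq> Pow (A \<times> B)"
      using sets.space_closed[of ?P] by (simp add: space_pair_measure space_uniform_count_measure)
    show "Pow (A \<times> B) \<subseteq> sets ?P"
    proof
      fix S assume "S \<in> Pow (A \<times> B)"
      moreover from this have "finite S"
        using assms by (auto intro: finite_subset)
      ultimately have "(\<Union>z\<in>S. {z}) \<in> sets ?P"
        by (intro sets.finite_UN single) auto
      then show "S \<in> sets ?P" by simp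
    qed
  qed
  show ?thesis
  proof (rule measure_eqI_finite[OF sets])
    show "sets (uniform_count_measure (A \<times> B)) = Pow (A \<times> B)"
      by (simp add: sets_uniform_count_measure)
    show "finite (A \<times> B)" using assms by simp
    fix z assume z: "z \<in> A \<times> B"
    have "emeasure ?P ({fst z} \<times> {snd z}) =
        emeasure (uniform_count_measure A) {fst z} * emeasure (uniform_count_measure B) {snd z}"
      using z by (intro B.emeasure_pair_measure_Times) (auto simp: sets_uniform_count_measure)
    also have "\<dots> = ennreal (1 / (card A * card B))"
      using z assms False
      by (auto simp: emeasure_uniform_count_measure ennreal_mult[symmetric])
    finally show "emeasure ?P {z} = emeasure (uniform_count_measure (A \<times> B)) {z}"
      using z assms by (simp add: emeasure_uniform_count_measure card_cartesian_product)
  qed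
qed

text \<open>Such an event is a finite disjoint union of cylinders, one for each prefix of length
  \<open>m\<close> that satisfies \<open>P\<close>, and each cylinder has measure
  \<open>1 / card X ^ m\<close>. All later probabilities thus become finite averages.\<close>

lemma
  fixes X :: "'a set"
  assumes X: "finite X" "X \<noteq> {}"
    and dep: "\<And>w w'. (\<And>i. i < m \<Longrightarrow> w i = w' i) \<Longrightarrow> P w = P w'"
    and M_def: "M = (\<Pi>\<^sub>M t\<in>(UNIV :: nat set). uniform_count_measure X)"
  shows sets_prefix_event: "{w \<in> space M. P w} \<in> sets M"
    and measure_prefix_event: "measure M {w \<in> space M. P w} = avg (seqs X m) (\<lambda>w. of_bool (P w))"
proof -
  interpret N: prob_space "uniform_count_measure X"
    using X by (rule prob_space_uniform_count_measure)
  interpret product_prob_space "\<lambda>_::nat. uniform_count_measure X" UNIV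
    by unfold_locales
  let ?N = "\<lambda>_::nat. uniform_count_measure X"
  define cyl where "cyl f = prod_emb UNIV ?N {..<m} (PiE {..<m} (\<lambda>i. {f i}))" for f
  let ?S = "{f \<in> seqs X m. P f}"
  have fin: "finite ?S"
    using X by (auto intro!: finite_subset[OF _ finite_PiE[of "{..<m}" "\<lambda>_. X"]])
  have space: "space M = UNIV \<rightarrow> X"
    by (auto simp: M_def space_PiM space_uniform_count_measure)
  have cyl: "cyl f = {w \<in> UNIV \<rightarrow> X. \<forall>i<m. w i = f i}" if "f \<in> seqs X m" for f
    unfolding cyl_def prod_emb_def
    by (auto simp: space_PiM space_uniform_count_measure PiE_iff Pi_iff)
  have Un: "{w \<in> space M. P w} = (\<Union>f\<in>?S. cyl f)"
  proof (intro set_eqI iffI)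
    fix w assume "w \<in> {w \<in> space M. P w}"
    then have w: "w \<in> UNIV \<rightarrow> X" "P w" by (auto simp: space)
    have r: "restrict w {..<m} \<in> seqs X m" using w by auto
    moreover have "P (restrict w {..<m})"
      using w(2) dep[of "restrict w {..<m}" w] by auto
    moreover have "w \<in> cyl (restrict w {..<m})"
      unfolding cyl[OF r] using w by auto
    ultimately show "w \<in> (\<Union>f\<in>?S. cyl f)" by blast
  next
    fix w assume "w \<in> (\<Union>f\<in>?S. cyl f)"
    then obtain f where f: "f \<in> seqs X m" "P f" "w \<in> cyl f" by auto
    from f(3) have "w \<in> UNIV \<rightarrow> X" "\<And>i. i < m \<Longrightarrow> w i = f i"
      unfolding cyl[OF f(1)] by auto
    then show "w \<in> {w \<in> space M. P w}"
      using f(2) dep[of w f] by (auto simp: space)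
  qed
  have sets: "cyl f \<in> sets M" if "f \<in> ?S" for f
    unfolding cyl_def M_def using that
    by (intro sets_PiM_I) (auto simp: sets_uniform_count_measure)
  show "{w \<in> space M. P w} \<in> sets M"
    unfolding Un using sets fin by auto
  have meas: "measure M (cyl f) = 1 / real (card X) ^ m" if "f \<in> ?S" for f
  proof -
    have "measure M (cyl f) = (\<Prod>i<m. measure (uniform_count_measure X) {f i})"
      unfolding cyl_def M_def using that
      by (intro measure_PiM_emb) (auto simp: sets_uniform_count_measure)
    also have "\<dots> = (\<Prod>i<m. 1 / real (card X))"
      using that X by (intro prod.cong) (auto simp: measure_uniform_count_measure PiE_iff)
    finally show ?thesis by (simp add: power_one_over)
  qed
  have disj: "disjoint_family_on cyl ?S"
  proof (unfold disjoint_family_on_def, intro ballI impI equals0I)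
    fix f g w assume fg: "f \<in> ?S" "g \<in> ?S" "f \<noteq> g" "w \<in> cyl f \<inter> cyl g"
    then have "f i = g i" if "i < m" for i
      using cyl that by fastforce
    then have "f = g"
      using fg by (intro PiE_ext[of f "{..<m}" "\<lambda>_. X" g]) auto
    with fg show False by simp
  qed
  have "measure M {w \<in> space M. P w} = (\<Sum>f\<in>?S. measure M (cyl f))"
    unfolding Un using sets fin disj
    by (intro measure_finite_Union) (auto simp: emeasure_eq_measure M_def)
  also have "\<dots> = real (card ?S) / real (card X) ^ m"
    using meas by simp
  also have "\<dots> = avg (seqs X m) (\<lambda>w. of_bool (P w))"
    using X by (simp add: avg_def card_PiE finite_PiE sum.If_cases of_bool_def Int_def)
  finally show "measure M {w \<in> space M. P w} = avg (seqs X m) (\<lambda>w. of_bool (P w))" .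
qed

section \<open>The non-backtracking walk\<close>

text \<open>The rank map \<open>f\<close> is strictly increasing along \<open>r\<close>, hence
  injective into \<open>{1..card S}\<close> and onto by cardinality; \<open>ranked r S\<close> is
  its inverse.\<close>

lemma bij_betw_ranked:
  assumes "finite S" "strict_linear_order_on S r"
  shows "bij_betw (ranked r S) {1..card S} S"
proof -
  define f where "f x = card {y \<in> S. (y, x) \<in> r} + 1" for x
  have tr: "trans r" and ir: "irrefl r" and tot: "total_on S r"
    using assms(2) by (auto simp: strict_linear_order_on_def)
  have less: "f x < f y" if "x \<in> S" "(x, y) \<in> r" for x y
  proof -
    have "{z \<in> S. (z, x) \<in> r} \<subseteq> {z \<in> S. (z, y) \<in> r}"
      using tr that(2) by (auto dest: transD)
    moreover have "x \<in> {z \<in> S. (z, y) \<in> r} - {z \<in> S. (z, x) \<in> r}"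
      using that ir by (auto simp: irrefl_def)
    ultimately have "{z \<in> S. (z, x) \<in> r} \<subset> {z \<in> S. (z, y) \<in> r}" by blast
    then show ?thesis unfolding f_def using assms(1) by (simp add: psubset_card_mono)
  qed
  have inj: "inj_on f S"
  proof (rule inj_onI, rule ccontr)
    fix x y assume "x \<in> S" "y \<in> S" "f x = f y" "x \<noteq> y"
    then show False using tot less[of x y] less[of y x] by (auto simp: total_on_def)
  qed
  have "f ` S \<subseteq> {1..card S}"
  proof
    fix i assume "i \<in> f ` S"
    then obtain x where x: "x \<in> S" "i = f x" by auto
    have "{y \<in> S. (y, x) \<in> r} \<subset> S" using x ir by (auto simp: irrefl_def)
    then have "card {y \<in> S. (y, x) \<in> r} < card S" using assms(1) by (rule psubset_card_mono[rotated])
    then show "i \<in> {1..card S}" using x by (auto simp: f_def)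
  qed
  then have img: "f ` S = {1..card S}"
    using inj by (intro card_subset_eq) (auto simp: card_image)
  have ranked: "ranked r S (f x) = x" if "x \<in> S" for x
    unfolding ranked_def f_def[symmetric]
    using that inj by (intro the_equality) (auto dest: inj_onD)
  show ?thesis
  proof (rule bij_betwI[where g = f])
    show "ranked r S \<in> {1..card S} \<rightarrow> S"
      unfolding img[symmetric] using ranked by auto
    show "f \<in> S \<rightarrow> {1..card S}" using img by auto
    show "ranked r S (f x) = x" if "x \<in> S" for x using ranked that .
    show "f (ranked r S i) = i" if "i \<in> {1..card S}" for i
      using that unfolding img[symmetric] using ranked by auto
  qed
qed

locale scheme =
  fixes k :: nat and G :: "'v pair_pre_digraph" and ord :: "'v \<Rightarrow> 'v rel"
    and \<tau> :: nat and tie :: "'v config list \<Rightarrow> bool"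
  assumes k: "2 \<le> k"
    and graph: "connected_regular_graph k G"
    and ord: "\<And>i. i \<in> pverts G \<Longrightarrow> strict_linear_order_on (neighbours G i) (ord i)"
    and nonempty: "pverts G \<noteq> {}"
    and tau: "1 \<le> \<tau>"
begin

abbreviation "V \<equiv> pverts G"
abbreviation "E \<equiv> parcs G"
abbreviation "D \<equiv> {1..k - 1}"
abbreviation "next_arc \<equiv> next_edge G ord"
abbreviation "nb \<equiv> neighbours G"

sublocale pair_graph G
  using graph by (simp add: connected_regular_graph_def)

lemma finite_V: "finite V" and finite_E: "finite E"
  using pair_finite_verts pair_finite_arcs by auto

lemma card_nb: "v \<in> V \<Longrightarrow> card (nb v) = k"
  using graph by (simp add: connected_regular_graph_def)

lemma arc_sym: "(i, j) \<in> E \<Longrightarrow> (j, i) \<in> E"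
  using pair_sym_arcs by (auto simp: symmetric_def dest: symD)

lemma finite_nb: "finite (nb i)"
  using finite_imageI[OF finite_E, of snd]
  by (rule finite_subset[rotated]) (force simp: neighbours_def)

lemma nbD: "j \<in> nb i \<Longrightarrow> (i, j) \<in> E \<and> i \<in> V \<and> j \<in> V \<and> i \<in> nb j"
  using arc_fst_in_verts[of "(i, j)"] arc_snd_in_verts[of "(i, j)"] arc_sym
  by (auto simp: neighbours_def)

lemma D_nonempty: "D \<noteq> {}"
  using k by auto

lemma E_sum: "(\<Sum>e\<in>E. f e) = (\<Sum>i\<in>V. \<Sum>j\<in>nb i. f (j, i))"
proof -
  have "E = prod.swap ` Sigma V nb"
    using nbD by (force simp: neighbours_def image_iff)
  then have "(\<Sum>e\<in>E. f e) = (\<Sum>e\<in>Sigma V nb. f (prod.swap e))"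
    by (simp add: sum.reindex)
  also have "\<dots> = (\<Sum>i\<in>V. \<Sum>j\<in>nb i. f (j, i))"
    using finite_V finite_nb by (simp add: sum.Sigma split_def prod.swap_def)
  finally show ?thesis .
qed

lemma E_sum': "(\<Sum>e\<in>E. f e) = (\<Sum>i\<in>V. \<Sum>j\<in>nb i. f (i, j))"
proof -
  have "E = Sigma V nb"
    using nbD by (force simp: neighbours_def)
  then show ?thesis
    using finite_V finite_nb by (simp add: sum.Sigma split_def)
qed

lemma card_E: "card E = k * card V"
proof -
  have "card E = (\<Sum>i\<in>V. \<Sum>j\<in>nb i. 1)"
    using E_sum[of "\<lambda>_. 1 :: nat"] by simp
  then show ?thesis using card_nb by simp
qed

lemma E_nonempty: "E \<noteq> {}"
  using card_E k nonempty finite_V by (metis card.empty card_0_eq mult_is_0 not_numeral_le_zero)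

lemma bij_next_arc:
  assumes "(j, i) \<in> E"
  shows "bij_betw (next_arc (j, i)) D ((\<lambda>i'. (i, i')) ` (nb i - {j}))"
proof -
  have i: "i \<in> V" "j \<in> nb i"
    using nbD[of i j] assms arc_sym by (auto simp: neighbours_def dest: arc_snd_in_verts)
  have "strict_linear_order_on (nb i - {j}) (ord i)"
    using ord[OF i(1)] by (auto simp: strict_linear_order_on_def total_on_def)
  then have "bij_betw (ranked (ord i) (nb i - {j})) {1..card (nb i - {j})} (nb i - {j})"
    using finite_nb by (intro bij_betw_ranked) auto
  moreover have "card (nb i - {j}) = k - 1"
    using i card_nb finite_nb by simp
  ultimately have "bij_betw (ranked (ord i) (nb i - {j})) D (nb i - {j})" by simp
  moreover have "bij_betw (Pair i) (nb i - {j}) (Pair i ` (nb i - {j}))"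
    by (intro inj_on_imp_bij_betw inj_onI) auto
  ultimately have "bij_betw (Pair i \<circ> ranked (ord i) (nb i - {j})) D (Pair i ` (nb i - {j}))"
    by (rule bij_betw_trans)
  then show ?thesis by (simp add: next_edge_def o_def cong: bij_betw_cong)
qed

lemma next_arc_in_E:
  assumes "e \<in> E" "d \<in> D"
  shows "next_arc e d \<in> E"
proof -
  have "next_arc e d \<in> Pair (snd e) ` (nb (snd e) - {fst e})"
    using bij_betwE[OF bij_next_arc[of "fst e" "snd e"]] assms by simp
  then show ?thesis by (auto simp: neighbours_def)
qed

text \<open>Stationarity of the uniform law on arcs: the arc (i, i') is reached from exactly the k -
  1 arcs (j, i) with j different from i', and each arc has k - 1 successors. In the computation the
  excluded backtracking terms appear as the subtracted \<open>f (i, j)\<close>.\<close>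

lemma avg_next_arc: "avg E (\<lambda>e. avg D (\<lambda>d. f (next_arc e d))) = avg E f"
proof -
  have "(\<Sum>e\<in>E. \<Sum>d\<in>D. f (next_arc e d)) = (\<Sum>i\<in>V. \<Sum>j\<in>nb i. \<Sum>d\<in>D. f (next_arc (j, i) d))"
    by (rule E_sum)
  also have "\<dots> = (\<Sum>i\<in>V. \<Sum>j\<in>nb i. \<Sum>i'\<in>nb i - {j}. f (i, i'))"
  proof (intro sum.cong refl)
    fix i j assume "i \<in> V" "j \<in> nb i"
    then have "(j, i) \<in> E" using nbD[of j i] by (auto simp: neighbours_def intro: arc_sym)
    then have bij: "bij_betw (next_arc (j, i)) D ((\<lambda>i'. (i, i')) ` (nb i - {j}))" by (rule bij_next_arc)
    have "(\<Sum>d\<in>D. f (next_arc (j, i) d)) = sum f ((\<lambda>i'. (i, i')) ` (nb i - {j}))"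
      by (rule sum.reindex_bij_betw[OF bij])
    also have "\<dots> = (\<Sum>i'\<in>nb i - {j}. f (i, i'))"
      by (subst sum.reindex) (auto simp: inj_on_def)
    finally show "(\<Sum>d\<in>D. f (next_arc (j, i) d)) = (\<Sum>i'\<in>nb i - {j}. f (i, i'))" .
  qed
  also have "\<dots> = (\<Sum>i\<in>V. real (k - 1) * (\<Sum>i'\<in>nb i. f (i, i')))"
  proof (intro sum.cong refl)
    fix i assume i: "i \<in> V"
    have "(\<Sum>j\<in>nb i. \<Sum>i'\<in>nb i - {j}. f (i, i')) = (\<Sum>j\<in>nb i. (\<Sum>i'\<in>nb i. f (i, i')) - f (i, j))"
      using finite_nb by (intro sum.cong) (auto simp: sum_diff1)
    also have "\<dots> = real (k - 1) * (\<Sum>i'\<in>nb i. f (i, i'))"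
      using k card_nb[OF i] by (simp add: sum_subtractf of_nat_diff algebra_simps)
    finally show "(\<Sum>j\<in>nb i. \<Sum>i'\<in>nb i - {j}. f (i, i')) = real (k - 1) * (\<Sum>i'\<in>nb i. f (i, i'))" .
  qed
  also have "\<dots> = real (k - 1) * (\<Sum>e\<in>E. f e)"
    by (simp add: E_sum' sum_distrib_left)
  finally have "(\<Sum>e\<in>E. \<Sum>d\<in>D. f (next_arc e d)) = real (k - 1) * (\<Sum>e\<in>E. f e)" .
  then show ?thesis
    using k by (simp add: avg_def sum_divide_distrib[symmetric])
qed

lemma avg_end: "avg E (\<lambda>e. of_bool (snd e \<in> B)) = real (card (V \<inter> B)) / real (card V)"
proof -
  have "(\<Sum>e\<in>E. of_bool (snd e \<in> B)) = (\<Sum>i\<in>V. real k * of_bool (i \<in> B))"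
    by (simp add: E_sum card_nb)
  also have "\<dots> = real k * real (card (V \<inter> B))"
    using finite_V by (simp add: sum_distrib_left[symmetric])
  finally show ?thesis using k by (simp add: avg_def card_E)
qed

abbreviation "seeds \<equiv> D \<times> D \<times> E \<times> E"

lemma finite_seeds: "finite seeds" and seeds_nonempty: "seeds \<noteq> {}"
  using finite_E E_nonempty D_nonempty by auto

lemma avg_seeds:
  "avg seeds f = avg D (\<lambda>d1. avg D (\<lambda>d2. avg E (\<lambda>r1. avg E (\<lambda>r2. f (d1, d2, r1, r2)))))"
  by (simp add: avg_Times)

lemma seed_space_eq: "seed_space k G = (\<Pi>\<^sub>M t\<in>(UNIV :: nat set). uniform_count_measure seeds)"
  unfolding seed_space_def using finite_E by (simp add: pair_uniform_count_measure)

lemma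
  assumes "\<And>w w'. (\<And>i. i < m \<Longrightarrow> w i = w' i) \<Longrightarrow> P w = P w'"
  shows sets_seed_event: "{w \<in> space (seed_space k G). P w} \<in> sets (seed_space k G)"
    and measure_seed_event: "measure (seed_space k G) {w \<in> space (seed_space k G). P w} =
      avg (seqs seeds m) (\<lambda>w. of_bool (P w))"
  by (rule sets_prefix_event[OF finite_seeds seeds_nonempty _ seed_space_eq], erule assms)
    (rule measure_prefix_event[OF finite_seeds seeds_nonempty _ seed_space_eq], erule assms)

section \<open>Configurations and loads\<close>

abbreviation "cfg \<equiv> config_at G ord \<tau>"
abbreviation "ld \<equiv> load G ord \<tau> tie"
abbreviation "must \<equiv> must_restart G ord \<tau>"

definition move :: "'v config \<Rightarrow> nat \<Rightarrow> nat \<Rightarrow> 'v config" where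
  "move s d1 d2 = (let e1 = next_arc (psi1 s) d1; e2 = next_arc (psi2 s) d2
     in \<lparr>psi1 = e1, psi2 = e2, visited = visited s \<union> {snd e1, snd e2}, counter = counter s + 1\<rparr>)"

lemma move_sel [simp]:
  "psi1 (move s d1 d2) = next_arc (psi1 s) d1" "psi2 (move s d1 d2) = next_arc (psi2 s) d2"
  "counter (move s d1 d2) = Suc (counter s)"
  "visited (move s d1 d2) = visited s \<union> {snd (next_arc (psi1 s) d1), snd (next_arc (psi2 s) d2)}"
  by (auto simp: move_def Let_def)

lemma start_sel [simp]:
  "psi1 (start_config r1 r2) = r1" "psi2 (start_config r1 r2) = r2"
  "counter (start_config r1 r2) = 0" "visited (start_config r1 r2) = {snd r1, snd r2}"
  by (auto simp: start_config_def)

lemma step_eq: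
  "step G ord \<tau> s (d1, d2, r1, r2) = (if must s d1 d2 then start_config r1 r2 else move s d1 d2)"
  by (simp add: step_def move_def)

lemma cfg_Suc:
  assumes "w (Suc t) = (d1, d2, r1, r2)"
  shows "cfg w (Suc t) = (if must (cfg w t) d1 d2 then start_config r1 r2 else move (cfg w t) d1 d2)"
  using assms by (simp add: step_eq)

lemma cfg_cong: "(\<And>i. i \<le> t \<Longrightarrow> w i = w' i) \<Longrightarrow> cfg w t = cfg w' t"
  by (induction t) auto

lemma ld_cong: "(\<And>i. i < t \<Longrightarrow> w i = w' i) \<Longrightarrow> ld w t = ld w' t"
proof (induction t)
  case (Suc t)
  have cfg: "cfg w i = cfg w' i" if "i \<le> t" for i
    using Suc.prems that by (intro cfg_cong) auto
  then have "map (cfg w) [0..<Suc t] = map (cfg w') [0..<Suc t]" by auto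
  moreover have "ld w t = ld w' t" using Suc by auto
  moreover have "cfg w t = cfg w' t" using cfg by simp
  ultimately show ?case by (simp only: load.simps)
qed simp

lemma cfg_in_E:
  assumes "\<And>i. i \<le> t \<Longrightarrow> w i \<in> seeds"
  shows "psi1 (cfg w t) \<in> E" "psi2 (cfg w t) \<in> E"
proof -
  have "psi1 (cfg w t) \<in> E \<and> psi2 (cfg w t) \<in> E"
    using assms
  proof (induction t)
    case 0
    then show ?case using 0[of 0] by (auto split: prod.splits)
  next
    case (Suc t)
    obtain d1 d2 r1 r2 where x: "w (Suc t) = (d1, d2, r1, r2)" by (metis prod_cases4)
    have "d1 \<in> D" "d2 \<in> D" "r1 \<in> E" "r2 \<in> E" using Suc.prems[of "Suc t"] x by auto
    then show ?case unfolding cfg_Suc[of w, OF x] using Suc by (auto intro: next_arc_in_E)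
  qed
  then show "psi1 (cfg w t) \<in> E" "psi2 (cfg w t) \<in> E" by auto
qed

lemma counter_le: "counter (cfg w t) \<le> t"
proof (induction t)
  case (Suc t)
  obtain d1 d2 r1 r2 where x: "w (Suc t) = (d1, d2, r1, r2)" by (metis prod_cases4)
  show ?case unfolding cfg_Suc[of w, OF x] using Suc by auto
qed (auto split: prod.splits)

lemma counter_less: "counter (cfg w t) < \<tau>"
proof (induction t)
  case 0
  then show ?case using tau by (auto split: prod.splits)
next
  case (Suc t)
  obtain d1 d2 r1 r2 where x: "w (Suc t) = (d1, d2, r1, r2)" by (metis prod_cases4)
  show ?case unfolding cfg_Suc[of w, OF x] using Suc tau by (auto simp: must_restart_def)
qed

definition epoch_start :: "(nat \<Rightarrow> 'v seed) \<Rightarrow> nat \<Rightarrow> nat" where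
  "epoch_start w t = t - counter (cfg w t)"

lemma ends_visited: "snd (psi1 (cfg w t)) \<in> visited (cfg w t)" "snd (psi2 (cfg w t)) \<in> visited (cfg w t)"
proof -
  have "snd (psi1 (cfg w t)) \<in> visited (cfg w t) \<and> snd (psi2 (cfg w t)) \<in> visited (cfg w t)"
  proof (cases t)
    case 0
    then show ?thesis by (auto split: prod.splits)
  next
    case (Suc t)
    obtain d1 d2 r1 r2 where x: "w (Suc t) = (d1, d2, r1, r2)" by (metis prod_cases4)
    show ?thesis unfolding Suc cfg_Suc[of w, OF x] by auto
  qed
  then show "snd (psi1 (cfg w t)) \<in> visited (cfg w t)" "snd (psi2 (cfg w t)) \<in> visited (cfg w t)"
    by auto
qed

definition chosen :: "(nat \<Rightarrow> 'v seed) \<Rightarrow> nat \<Rightarrow> 'v" where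
  "chosen w t = (let Q = ld w t; w1 = snd (psi1 (cfg w t)); w2 = snd (psi2 (cfg w t))
     in if Q w1 < Q w2 then w1 else if Q w2 < Q w1 then w2
        else if tie (map (cfg w) [0..<Suc t]) then w1 else w2)"

lemma ld_Suc: "ld w (Suc t) = (ld w t)(chosen w t := ld w t (chosen w t) + 1)"
  by (simp add: chosen_def Let_def del: upt_Suc)

declare load.simps(2) [simp del]

lemma chosen_cases: "chosen w t = snd (psi1 (cfg w t)) \<or> chosen w t = snd (psi2 (cfg w t))"
  by (auto simp: chosen_def Let_def)

lemma ld_chosen:
  "ld w t (chosen w t) \<le> ld w t (snd (psi1 (cfg w t)))"
  "ld w t (chosen w t) \<le> ld w t (snd (psi2 (cfg w t)))"
  by (auto simp: chosen_def Let_def)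

lemma chosen_visited: "chosen w t \<in> visited (cfg w t)"
  using chosen_cases[of w t] ends_visited[of w t] by auto

lemma ld_mono: "s \<le> t \<Longrightarrow> ld w s v \<le> ld w t v"
  by (induction rule: dec_induct) (auto simp: ld_Suc)

text \<open>No vertex is visited at two times of one epoch, so the walkers see the loads from its start.\<close>

lemma ld_epoch:
  "(\<forall>v. v \<notin> visited (cfg w t) \<longrightarrow> ld w (Suc t) v = ld w (epoch_start w t) v) \<and>
   ld w t (snd (psi1 (cfg w t))) = ld w (epoch_start w t) (snd (psi1 (cfg w t))) \<and>
   ld w t (snd (psi2 (cfg w t))) = ld w (epoch_start w t) (snd (psi2 (cfg w t)))"
proof (induction t)
  case 0
  then show ?case using chosen_visited[of w 0] by (auto simp: epoch_start_def ld_Suc)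
next
  case (Suc t)
  obtain d1 d2 r1 r2 where x: "w (Suc t) = (d1, d2, r1, r2)" by (metis prod_cases4)
  note ch = chosen_visited[of w "Suc t"]
  note eq = cfg_Suc[of w, OF x]
  show ?case
  proof (cases "must (cfg w t) d1 d2")
    case True
    then have "epoch_start w (Suc t) = Suc t" by (simp add: epoch_start_def eq del: config_at.simps)
    then show ?thesis using ch by (auto simp: ld_Suc[of w "Suc t"])
  next
    case False
    then have cfg: "cfg w (Suc t) = move (cfg w t) d1 d2" by (simp add: eq del: config_at.simps)
    then have st: "epoch_start w (Suc t) = epoch_start w t"
      by (simp add: epoch_start_def del: config_at.simps)
    \<comment> \<open>Without a restart both new positions lie outside the old visited set, so the
      first conjunct of the induction hypothesis applies to them. It is stated at
      \<open>Suc t\<close> to take in the ball placed at time \<open>t\<close>.\<close>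
    have "ld w (Suc t) v = ld w (epoch_start w t) v" if "v \<notin> visited (cfg w t)" for v
      using Suc that by auto
    then show ?thesis
      using False ch unfolding st ld_Suc[of w "Suc t"] cfg
      by (auto simp: must_restart_def)
  qed
qed

section \<open>Heavy bins, and hits as a bound on their number\<close>

definition heavy :: "nat \<Rightarrow> (nat \<Rightarrow> 'v seed) \<Rightarrow> nat \<Rightarrow> 'v set" where
  "heavy h w t = {v \<in> V. h \<le> ld w t v}"

lemma finite_heavy: "finite (heavy h w t)"
  using finite_V by (simp add: heavy_def)

lemma heavy_mono: "s \<le> t \<Longrightarrow> heavy h w s \<subseteq> heavy h w t"
  using ld_mono by (fastforce simp: heavy_def intro: order_trans)

lemma heavy_cong: "(\<And>i. i < t \<Longrightarrow> w i = w' i) \<Longrightarrow> heavy h w t = heavy h w' t"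
  unfolding heavy_def by (simp add: ld_cong[of t w w'])

definition hit :: "'v set \<Rightarrow> 'v config \<Rightarrow> real" where
  "hit B s = of_bool (snd (psi1 s) \<in> B \<and> snd (psi2 s) \<in> B)"

lemma hit_nonneg: "0 \<le> hit B s" and hit_le_1: "hit B s \<le> 1"
  by (auto simp: hit_def)

text \<open>The set is emptied when it is too large: this makes the bound on its size unconditional, and it
  changes nothing on the event that few bins are heavy at the end.\<close>

definition bset :: "nat \<Rightarrow> real \<Rightarrow> (nat \<Rightarrow> 'v seed) \<Rightarrow> nat \<Rightarrow> 'v set" where
  "bset h p w t = (let A = heavy h w (epoch_start w t) in if real (card A) \<le> p * real (card V) then A else {})"

lemma bset_cong: "(\<And>i. i \<le> t \<Longrightarrow> w i = w' i) \<Longrightarrow> bset h p w t = bset h p w' t"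
  using cfg_cong[of t w w'] heavy_cong[of "t - counter (cfg w' t)" w w' h]
  by (simp add: bset_def epoch_start_def)

lemma card_bset: "0 \<le> p \<Longrightarrow> real (card (V \<inter> bset h p w t)) \<le> p * real (card V)"
proof -
  assume "0 \<le> p"
  have "card (V \<inter> bset h p w t) \<le> card (bset h p w t)"
    by (intro card_mono) (auto simp: bset_def Let_def finite_heavy)
  moreover have "real (card (bset h p w t)) \<le> p * real (card V)"
    using \<open>0 \<le> p\<close> by (auto simp: bset_def Let_def)
  ultimately show ?thesis by linarith
qed

text \<open>A bin reaches load \<open>Suc h\<close> only through a ball that lands on load at least
  \<open>h\<close>. The chosen bin is the less loaded one, so both walkers then stand on load at
  least \<open>h\<close>, and by \<open>ld_epoch\<close> these bins were already heavy when the
  epoch began: that time counts as a hit.\<close>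

lemma card_heavy_le_hits:
  assumes "t \<le> n" "real (card (heavy h w n)) \<le> p * real (card V)" "\<And>i. i < n \<Longrightarrow> w i \<in> seeds"
  shows "real (card (heavy (Suc h) w t)) \<le> (\<Sum>s<t. hit (bset h p w s) (cfg w s))"
  using assms(1)
proof (induction t)
  case 0
  then show ?case by (simp add: heavy_def)
next
  case (Suc t)
  let ?c = "chosen w t" and ?S = "epoch_start w t"
  have IH: "real (card (heavy (Suc h) w t)) \<le> (\<Sum>s<t. hit (bset h p w s) (cfg w s))"
    using Suc by simp
  show ?case
  proof (cases "h \<le> ld w t ?c")
    case False
    then have "heavy (Suc h) w (Suc t) \<subseteq> heavy (Suc h) w t"
      by (auto simp: heavy_def ld_Suc split: if_splits)
    then have "card (heavy (Suc h) w (Suc t)) \<le> card (heavy (Suc h) w t)"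
      by (intro card_mono finite_heavy)
    then show ?thesis using IH hit_nonneg[of "bset h p w t" "cfg w t"] by simp
  next
    case True
    have "heavy (Suc h) w (Suc t) \<subseteq> insert ?c (heavy (Suc h) w t)"
      by (auto simp: heavy_def ld_Suc split: if_splits)
    then have "card (heavy (Suc h) w (Suc t)) \<le> card (insert ?c (heavy (Suc h) w t))"
      by (intro card_mono) (auto simp: finite_heavy)
    then have le: "card (heavy (Suc h) w (Suc t)) \<le> Suc (card (heavy (Suc h) w t))"
      using finite_heavy by (auto simp: card_insert_if split: if_splits)
    have E: "psi1 (cfg w t) \<in> E" "psi2 (cfg w t) \<in> E"
      using Suc.prems assms(3) by (auto intro!: cfg_in_E)
    \<comment> \<open>Heavy sets only grow, so the size bound at the final time \<open>n\<close>
      holds at every epoch start, and \<open>bset\<close> is never emptied.\<close>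
    have "?S \<le> n" using Suc.prems by (auto simp: epoch_start_def)
    then have "card (heavy h w ?S) \<le> card (heavy h w n)"
      by (intro card_mono finite_heavy heavy_mono)
    then have "bset h p w t = heavy h w ?S"
      using assms(2) by (auto simp: bset_def Let_def)
    then have "hit (bset h p w t) (cfg w t) = 1"
      using ld_epoch[of w t] ld_chosen[of w t] True E arc_snd_in_verts
      by (auto simp: hit_def heavy_def)
    then show ?thesis using IH le by simp
  qed
qed

lemma sum_ld:
  assumes "\<And>i. i < t \<Longrightarrow> w i \<in> seeds"
  shows "(\<Sum>v\<in>V. ld w t v) = t"
  using assms
proof (induction t)
  case (Suc t)
  have "psi1 (cfg w t) \<in> E" "psi2 (cfg w t) \<in> E"
    using Suc.prems by (auto intro!: cfg_in_E)
  then have c: "chosen w t \<in> V"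
    using chosen_cases[of w t] arc_snd_in_verts by auto
  have "(\<Sum>v\<in>V. ld w (Suc t) v) = (\<Sum>v\<in>V. ld w t v + of_bool (v = chosen w t))"
    by (intro sum.cong) (auto simp: ld_Suc)
  also have "\<dots> = t + 1"
    using Suc c finite_V by (simp add: sum.distrib Int_absorb1)
  finally show ?case by simp
qed simp

lemma card_heavy_start:
  assumes "\<And>i. i < t \<Longrightarrow> w i \<in> seeds"
  shows "h * card (heavy h w t) \<le> t"
proof -
  have "h * card (heavy h w t) = (\<Sum>v\<in>heavy h w t. h)" by simp
  also have "\<dots> \<le> (\<Sum>v\<in>heavy h w t. ld w t v)"
    by (intro sum_mono) (auto simp: heavy_def)
  also have "\<dots> \<le> (\<Sum>v\<in>V. ld w t v)"
    using finite_V by (intro sum_mono2) (auto simp: heavy_def)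
  finally show ?thesis using sum_ld[OF assms] by simp
qed

section \<open>One epoch\<close>

text \<open>In the next three functions, \<open>r\<close> counts the steps until the period ends the epoch. In \<open>hit_value\<close>,
  \<open>a\<close> rewards the remaining hits and \<open>\<beta>\<close> charges the completion of a full period.\<close>

primrec hit_value :: "real \<Rightarrow> real \<Rightarrow> 'v set \<Rightarrow> nat \<Rightarrow> 'v config \<Rightarrow> real" where
  "hit_value a \<beta> B 0 s = - \<beta>"
| "hit_value a \<beta> B (Suc r) s = avg D (\<lambda>d1. avg D (\<lambda>d2. if must s d1 d2 then 0
     else a * hit B (move s d1 d2) + hit_value a \<beta> B r (move s d1 d2)))"

primrec full_prob :: "nat \<Rightarrow> 'v config \<Rightarrow> real" where
  "full_prob 0 s = 1"
| "full_prob (Suc r) s = avg D (\<lambda>d1. avg D (\<lambda>d2. if must s d1 d2 then 0 else full_prob r (move s d1 d2)))"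

primrec free_hits :: "'v set \<Rightarrow> nat \<Rightarrow> 'v \<times> 'v \<Rightarrow> 'v \<times> 'v \<Rightarrow> real" where
  "free_hits B 0 e1 e2 = 0"
| "free_hits B (Suc r) e1 e2 = avg D (\<lambda>d1. avg D (\<lambda>d2.
     of_bool (snd (next_arc e1 d1) \<in> B) * of_bool (snd (next_arc e2 d2) \<in> B)
     + free_hits B r (next_arc e1 d1) (next_arc e2 d2)))"

lemma free_hits_nonneg: "0 \<le> free_hits B r e1 e2"
proof (induction r arbitrary: e1 e2)
  case (Suc r)
  show ?case unfolding free_hits.simps by (intro avg_nonneg add_nonneg_nonneg Suc) auto
qed simp

text \<open>A restart replaces the remaining reward by 0, so dropping restarts can only increase the
  hit part. The charge enters negatively and needs the true probability of completing the period,
  hence the two different functions on the right.\<close>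

lemma hit_value_le:
  assumes "0 \<le> a"
  shows "hit_value a \<beta> B r s \<le> a * free_hits B r (psi1 s) (psi2 s) - \<beta> * full_prob r s"
proof (induction r arbitrary: s)
  case 0
  show ?case by simp
next
  case (Suc r)
  have "hit_value a \<beta> B (Suc r) s \<le> avg D (\<lambda>d1. avg D (\<lambda>d2.
      a * (of_bool (snd (next_arc (psi1 s) d1) \<in> B) * of_bool (snd (next_arc (psi2 s) d2) \<in> B)
        + free_hits B r (next_arc (psi1 s) d1) (next_arc (psi2 s) d2))
      - \<beta> * (if must s d1 d2 then 0 else full_prob r (move s d1 d2))))"
    unfolding hit_value.simps
  proof (intro avg_mono)
    fix d1 d2
    show "(if must s d1 d2 then 0 else a * hit B (move s d1 d2) + hit_value a \<beta> B r (move s d1 d2)) \<le>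
      a * (of_bool (snd (next_arc (psi1 s) d1) \<in> B) * of_bool (snd (next_arc (psi2 s) d2) \<in> B)
        + free_hits B r (next_arc (psi1 s) d1) (next_arc (psi2 s) d2))
      - \<beta> * (if must s d1 d2 then 0 else full_prob r (move s d1 d2))"
      using Suc[of "move s d1 d2"] assms free_hits_nonneg[of B r]
      by (auto simp: hit_def distrib_left of_bool_conj)
  qed
  also have "\<dots> = a * free_hits B (Suc r) (psi1 s) (psi2 s) - \<beta> * full_prob (Suc r) s"
    by (simp only: avg_diff avg_cmult free_hits.simps full_prob.simps)
  finally show ?case .
qed

lemma hit_value_ge:
  assumes "0 \<le> a" "0 \<le> \<beta>"
  shows "- \<beta> \<le> hit_value a \<beta> B r s"
proof (induction r arbitrary: s)
  case (Suc r)
  have "- \<beta> = avg D (\<lambda>d1. avg D (\<lambda>d2. - \<beta>))"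
    using D_nonempty by (simp add: avg_const)
  also have "\<dots> \<le> hit_value a \<beta> B (Suc r) s"
    unfolding hit_value.simps
  proof (intro avg_mono)
    fix d1 d2
    have "0 \<le> a * hit B (move s d1 d2)" using assms hit_nonneg by simp
    then show "- \<beta> \<le> (if must s d1 d2 then 0
        else a * hit B (move s d1 d2) + hit_value a \<beta> B r (move s d1 d2))"
      using Suc[of "move s d1 d2"] assms by auto
  qed
  finally show ?case .
qed simp

lemma avg_pair_end:
  "avg E (\<lambda>e1. avg E (\<lambda>e2. of_bool (snd e1 \<in> B) * of_bool (snd e2 \<in> B))) =
     (real (card (V \<inter> B)) / real (card V))\<^sup>2"
proof -
  have "avg E (\<lambda>e1. avg E (\<lambda>e2. of_bool (snd e1 \<in> B) * of_bool (snd e2 \<in> B))) =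
      avg E (\<lambda>e1. avg E (\<lambda>e2. of_bool (snd e2 \<in> B)) * of_bool (snd e1 \<in> B))"
    by (simp only: avg_cmult mult.commute)
  then show ?thesis by (simp only: avg_cmult avg_end power2_eq_square)
qed

text \<open>Without restarts the two walks are independent and stationary, so at each of the
  \<open>r\<close> steps both stand in \<open>B\<close> with the squared probability of one uniform
  vertex being in \<open>B\<close>.\<close>

lemma avg_free_hits:
  "avg E (\<lambda>e1. avg E (\<lambda>e2. free_hits B r e1 e2)) = r * (real (card (V \<inter> B)) / real (card V))\<^sup>2"
proof (induction r)
  case 0
  show ?case by (simp add: avg_def)
next
  case (Suc r)
  define g where "g e1 e2 = of_bool (snd e1 \<in> B) * of_bool (snd e2 \<in> B) + free_hits B r e1 e2" for e1 e2
  have "avg E (\<lambda>e1. avg E (\<lambda>e2. free_hits B (Suc r) e1 e2)) =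
      avg E (\<lambda>e1. avg E (\<lambda>e2. avg D (\<lambda>d1. avg D (\<lambda>d2. g (next_arc e1 d1) (next_arc e2 d2)))))"
    by (simp only: g_def free_hits.simps)
  \<comment> \<open>The average over the start of the second walk moves past the draw of the first,
    so that stationarity applies to each walk separately.\<close>
  also have "\<dots> = avg E (\<lambda>e1. avg D (\<lambda>d1. avg E (\<lambda>e2. avg D (\<lambda>d2. g (next_arc e1 d1) (next_arc e2 d2)))))"
    by (subst avg_commute[of E D]) (rule refl)
  also have "\<dots> = avg E (\<lambda>e1. avg E (\<lambda>e2. g e1 e2))"
    by (simp only: avg_next_arc[of "g (next_arc _ _)"] avg_next_arc[of "\<lambda>e. avg E (g e)"])
  also have "\<dots> = real (Suc r) * (real (card (V \<inter> B)) / real (card V))\<^sup>2"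
    unfolding g_def by (simp only: avg_add avg_pair_end Suc) (simp add: distrib_right)
  finally show ?case .
qed

text \<open>The hypothesis on the first restart time, in the form in which every epoch uses it: each
  restart draws fresh uniform arcs, so the bound is not special to the first epoch.\<close>

definition long_epochs :: bool where
  "long_epochs \<longleftrightarrow> 0.9 \<le> avg E (\<lambda>r1. avg E (\<lambda>r2. full_prob (\<tau> - 1) (start_config r1 r2)))"

text \<open>An epoch has at most \<tau> occasions for a hit, the start and \<tau> - 1 moves, so the
  mean reward is at most \<open>a * \<tau> * p\<^sup>2\<close>, while the mean charge is at least
  \<open>0.9 * \<beta>\<close>.\<close>

lemma avg_start_le_0:
  fixes a \<beta> p :: real
  assumes "long_epochs" "0 \<le> a" "0 \<le> \<beta>" "0 \<le> p" "real (card (V \<inter> B)) \<le> p * real (card V)"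
    "a * \<tau> * p\<^sup>2 \<le> 0.9 * \<beta>"
  shows "avg E (\<lambda>r1. avg E (\<lambda>r2. a * hit B (start_config r1 r2)
           + hit_value a \<beta> B (\<tau> - 1) (start_config r1 r2))) \<le> 0"
proof -
  define q where "q = (real (card (V \<inter> B)) / real (card V))\<^sup>2"
  have "real (card (V \<inter> B)) / real (card V) \<le> p"
    using assms(5) finite_V nonempty by (simp add: pos_divide_le_eq card_gt_0_iff)
  then have q: "q \<le> p\<^sup>2" unfolding q_def by (intro power_mono) auto
  define H :: "'v \<times> 'v \<Rightarrow> 'v \<times> 'v \<Rightarrow> real" where
    "H r1 r2 = of_bool (snd r1 \<in> B) * of_bool (snd r2 \<in> B)" for r1 r2
  have H: "avg E (\<lambda>r1. avg E (\<lambda>r2. H r1 r2)) = q"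
    unfolding H_def q_def by (rule avg_pair_end)
  have "avg E (\<lambda>r1. avg E (\<lambda>r2. a * hit B (start_config r1 r2)
           + hit_value a \<beta> B (\<tau> - 1) (start_config r1 r2))) \<le>
    avg E (\<lambda>r1. avg E (\<lambda>r2. a * (H r1 r2 + free_hits B (\<tau> - 1) r1 r2)
           - \<beta> * full_prob (\<tau> - 1) (start_config r1 r2)))"
  proof (intro avg_mono)
    fix r1 r2
    show "a * hit B (start_config r1 r2) + hit_value a \<beta> B (\<tau> - 1) (start_config r1 r2) \<le>
      a * (H r1 r2 + free_hits B (\<tau> - 1) r1 r2)
           - \<beta> * full_prob (\<tau> - 1) (start_config r1 r2)"
      using hit_value_le[OF assms(2), of \<beta> B "\<tau> - 1" "start_config r1 r2"]
      by (simp add: hit_def H_def distrib_left of_bool_conj)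
  qed
  also have "\<dots> = a * (q + (\<tau> - 1) * q)
      - \<beta> * avg E (\<lambda>r1. avg E (\<lambda>r2. full_prob (\<tau> - 1) (start_config r1 r2)))"
    by (simp only: avg_diff avg_cmult avg_add H avg_free_hits q_def)
  also have "\<dots> \<le> a * (\<tau> * q) - \<beta> * 0.9"
    using assms(1-3) tau unfolding long_epochs_def
    by (intro diff_mono mult_left_mono) (auto simp: of_nat_diff algebra_simps)
  also have "\<dots> \<le> a * (\<tau> * p\<^sup>2) - \<beta> * 0.9"
    using q assms(2,3) by (intro diff_mono mult_left_mono) auto
  finally show ?thesis using assms(6) by (simp add: mult.assoc)
qed

lemma long_epochsI:
  assumes "measure (seed_space k G) {w \<in> space (seed_space k G). first_restart G ord \<tau> w < \<tau>} \<le> 0.1"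
  shows "long_epochs"
proof -
  define free where "free w t \<longleftrightarrow> (\<forall>s. 1 \<le> s \<longrightarrow> s \<le> t \<longrightarrow> \<not> restart_at G ord \<tau> w s)" for w t
  have restart_cong: "restart_at G ord \<tau> w s = restart_at G ord \<tau> w' s"
    if "\<And>i. i \<le> s \<Longrightarrow> w i = w' i" for w w' s
  proof -
    have "w s = w' s" "cfg w (s - 1) = cfg w' (s - 1)"
      using that by (auto intro!: cfg_cong)
    then show ?thesis by (simp add: restart_at_def)
  qed
  have free_Suc: "free w (Suc t) \<longleftrightarrow> free w t \<and> \<not> restart_at G ord \<tau> w (Suc t)" for w t
    by (auto simp: free_def le_Suc_eq)
  have free_cong: "free w t = free w' t" if "\<And>i. i \<le> t \<Longrightarrow> w i = w' i" for w w' t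
  proof -
    have "restart_at G ord \<tau> w s = restart_at G ord \<tau> w' s" if "s \<le> t" for s
      using \<open>\<And>i. i \<le> t \<Longrightarrow> w i = w' i\<close> that by (intro restart_cong) auto
    then show ?thesis by (auto simp: free_def)
  qed
  have counter: "counter (cfg w t) = t" if "free w t" for w t
    using that
  proof (induction t)
    case (Suc t)
    obtain d1 d2 r1 r2 where x: "w (Suc t) = (d1, d2, r1, r2)" by (metis prod_cases4)
    show ?case unfolding cfg_Suc[of w, OF x] using Suc x by (auto simp: free_Suc restart_at_def)
  qed (auto split: prod.splits)
  have first: "first_restart G ord \<tau> w < \<tau> \<longleftrightarrow> \<not> free w (\<tau> - 1)" for w
  proof
    assume "\<not> free w (\<tau> - 1)"
    then obtain s where s: "1 \<le> s" "s \<le> \<tau> - 1" "restart_at G ord \<tau> w s" by (auto simp: free_def)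
    then have "first_restart G ord \<tau> w \<le> s" unfolding first_restart_def by (intro Least_le) auto
    with s tau show "first_restart G ord \<tau> w < \<tau>" by linarith
  next
    assume less: "first_restart G ord \<tau> w < \<tau>"
    show "\<not> free w (\<tau> - 1)"
    proof
      assume free: "free w (\<tau> - 1)"
      have "counter (cfg w (\<tau> - 1)) + 1 = \<tau>"
        using counter[OF free] tau by simp
      \<comment> \<open>The counter forces a restart at \<tau>, which gives the witness required for
        \<open>LEAST\<close>.\<close>
      then have "restart_at G ord \<tau> w \<tau>"
        by (simp add: restart_at_def must_restart_def split: prod.splits)
      then have "first_restart G ord \<tau> w \<ge> 1 \<and> restart_at G ord \<tau> w (first_restart G ord \<tau> w)"
        unfolding first_restart_def
        by (intro LeastI[of "\<lambda>t. 1 \<le> t \<and> restart_at G ord \<tau> w t" \<tau>] conjI tau)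
      moreover have "first_restart G ord \<tau> w \<le> \<tau> - 1" using less by linarith
      ultimately show False using free unfolding free_def by blast
    qed
  qed
  \<comment> \<open>The conditional probability, given the seeds at times below \<open>t\<close>,
    that no restart occurs at the times 1 to \<tau> - 1.\<close>
  define \<Phi> where "\<Phi> t w = (if t = 0 then avg E (\<lambda>r1. avg E (\<lambda>r2. full_prob (\<tau> - 1) (start_config r1 r2)))
    else of_bool (free w (t - 1)) * full_prob (\<tau> - t) (cfg w (t - 1)))" for t w
  have "avg (seqs seeds \<tau>) (\<Phi> \<tau>) \<le> \<Phi> 0 (\<lambda>_. undefined)"
  proof (rule avg_supermartingale)
    fix t and w :: "nat \<Rightarrow> 'v seed"
    assume t: "t < \<tau>"
    show "avg seeds (\<lambda>x. \<Phi> (Suc t) (w(t := x))) \<le> \<Phi> t w"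
    proof (cases t)
      case 0
      have "avg seeds (\<lambda>x. \<Phi> (Suc t) (w(t := x))) =
          avg D (\<lambda>d1. avg D (\<lambda>d2. avg E (\<lambda>r1. avg E (\<lambda>r2. full_prob (\<tau> - 1) (start_config r1 r2)))))"
        unfolding avg_seeds by (simp add: \<Phi>_def 0 free_def)
      then show ?thesis using D_nonempty by (simp add: avg_const \<Phi>_def 0)
    next
      case (Suc t')
      let ?s = "cfg w t'"
      have "\<Phi> (Suc t) (w(t := (d1, d2, r1, r2))) = of_bool (free w t') *
          (if must ?s d1 d2 then 0 else full_prob (\<tau> - Suc t) (move ?s d1 d2))" for d1 d2 r1 r2
      proof -
        let ?u = "w(t := (d1, d2, r1, r2))"
        have "cfg ?u t' = ?s" "free ?u t' = free w t'"
          using Suc by (auto intro!: cfg_cong free_cong)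
        then show ?thesis
          using cfg_Suc[of ?u t' d1 d2 r1 r2] Suc
          by (auto simp: \<Phi>_def free_Suc restart_at_def simp del: config_at.simps)
      qed
      then have "avg seeds (\<lambda>x. \<Phi> (Suc t) (w(t := x))) =
          of_bool (free w t') * full_prob (Suc (\<tau> - Suc t)) ?s"
        using finite_E E_nonempty unfolding avg_seeds full_prob.simps avg_cmult[symmetric]
        by (simp add: avg_const)
      then show ?thesis using Suc t by (simp add: \<Phi>_def Suc_diff_Suc del: full_prob.simps)
    qed
  qed
  moreover have "\<Phi> \<tau> = (\<lambda>w. of_bool (free w (\<tau> - 1)))"
    using tau by (auto simp: \<Phi>_def)
  moreover have "avg (seqs seeds \<tau>) (\<lambda>w. of_bool (\<not> free w (\<tau> - 1))) \<le> 0.1"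
  proof -
    have "measure (seed_space k G) {w \<in> space (seed_space k G). \<not> free w (\<tau> - 1)} =
        avg (seqs seeds \<tau>) (\<lambda>w. of_bool (\<not> free w (\<tau> - 1)))"
      using tau by (intro measure_seed_event arg_cong[where f = Not] free_cong) auto
    then show ?thesis using assms by (simp add: first)
  qed
  moreover have "avg (seqs seeds \<tau>) (\<lambda>w. of_bool (free w (\<tau> - 1)) + of_bool (\<not> free w (\<tau> - 1))) = 1"
  proof -
    have "(\<lambda>w. of_bool (free w (\<tau> - 1)) + of_bool (\<not> free w (\<tau> - 1))) = (\<lambda>w. 1 :: real)" by auto
    then show ?thesis
      using finite_seeds seeds_nonempty by (simp add: avg_const finite_PiE PiE_eq_empty_iff del: of_bool_eq_iff)
  qed
  ultimately show ?thesis
    by (simp add: avg_add long_epochs_def \<Phi>_def)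
qed

section \<open>The potential over many epochs\<close>

declare config_at.simps [simp del]

context
  fixes h :: nat and p a \<beta> :: real
begin

abbreviation "hits_at w t \<equiv> hit (bset h p w t) (cfg w t)"

primrec cur :: "(nat \<Rightarrow> 'v seed) \<Rightarrow> nat \<Rightarrow> real" where
  "cur w 0 = hits_at w 0"
| "cur w (Suc t) = hits_at w (Suc t) + (if counter (cfg w (Suc t)) = 0 then 0 else cur w t)"

primrec past :: "(nat \<Rightarrow> 'v seed) \<Rightarrow> nat \<Rightarrow> real" where
  "past w 0 = 1"
| "past w (Suc t) = past w t * (if counter (cfg w (Suc t)) = 0
     then 1 + a * cur w t - \<beta> * of_bool (counter (cfg w t) + 1 = \<tau>) else 1)"

text \<open>Finished epochs contribute their actual factors; the running epoch contributes the
  conditional expectation of its eventual factor, its heavy set being frozen since its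
  start.\<close>

definition potential :: "(nat \<Rightarrow> 'v seed) \<Rightarrow> nat \<Rightarrow> real" where
  "potential w t = past w t * (1 + a * cur w t
     + hit_value a \<beta> (bset h p w t) (\<tau> - 1 - counter (cfg w t)) (cfg w t))"

lemma hits_at_cong: "(\<And>i. i \<le> t \<Longrightarrow> w i = w' i) \<Longrightarrow> hits_at w t = hits_at w' t"
  by (metis bset_cong cfg_cong)

lemma cur_past_cong:
  "(\<And>i. i \<le> t \<Longrightarrow> w i = w' i) \<Longrightarrow> cur w t = cur w' t \<and> past w t = past w' t"
proof (induction t)
  case 0
  then show ?case using hits_at_cong[of 0 w w'] by simp
next
  case (Suc t)
  have "hits_at w (Suc t) = hits_at w' (Suc t)" "cfg w (Suc t) = cfg w' (Suc t)" "cfg w t = cfg w' t"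
    by (rule hits_at_cong cfg_cong, rule Suc.prems, simp)+
  moreover have "cur w t = cur w' t \<and> past w t = past w' t"
    using Suc.prems by (intro Suc.IH) auto
  ultimately show ?case by (simp only: cur.simps past.simps)
qed

lemma cur_nonneg: "0 \<le> cur w t"
  by (induction t) (use hit_nonneg in \<open>auto intro: add_nonneg_nonneg\<close>)

lemma cur_le: "cur w t \<le> counter (cfg w t) + 1"
proof (induction t)
  case 0
  then show ?case using hit_le_1[of "bset h p w 0" "cfg w 0"] by simp
next
  case (Suc t)
  obtain d1 d2 r1 r2 where x: "w (Suc t) = (d1, d2, r1, r2)" by (metis prod_cases4)
  have "counter (cfg w (Suc t)) = 0 \<or> counter (cfg w (Suc t)) = Suc (counter (cfg w t))"
    unfolding cfg_Suc[of w, OF x] by auto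
  then show ?case using Suc hit_le_1[of "bset h p w (Suc t)" "cfg w (Suc t)"]
    by (auto)
qed

lemma cur_le_tau: "cur w t \<le> \<tau>"
  using cur_le[of w t] counter_less[of w t] by linarith

context
  assumes a: "0 \<le> a" and \<beta>: "0 \<le> \<beta>" "\<beta> \<le> 1/2" and p: "0 \<le> p"
begin

lemma past_nonneg: "0 \<le> past w t"
proof (induction t)
  case (Suc t)
  have "0 \<le> a * cur w t" using a cur_nonneg by simp
  then have "0 \<le> 1 + a * cur w t - \<beta> * of_bool (counter (cfg w t) + 1 = \<tau>)" using \<beta> by auto
  then show ?case using Suc by simp
qed simp

text \<open>The difference of the hit total and \<open>cur\<close> counts the hits of finished
  epochs. The last condition on \<open>\<phi>\<close> absorbs one epoch at a time, and the exponent
  bounds the number of full epochs, since each occupies \<tau> of the times before the current epoch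
  start.\<close>

lemma past_ge:
  fixes \<phi> :: "real \<Rightarrow> real"
  assumes \<phi>: "\<phi> 0 \<le> 1" "\<And>x. 0 \<le> x \<Longrightarrow> 0 \<le> \<phi> x"
    "\<And>x y. 0 \<le> x \<Longrightarrow> 0 \<le> y \<Longrightarrow> y \<le> real \<tau> \<Longrightarrow> \<phi> (x + y) \<le> \<phi> x * (1 + a * y)"
  shows "0 \<le> (\<Sum>s\<le>t. hits_at w s) - cur w t \<and>
    (1 - \<beta>) ^ ((t - counter (cfg w t)) div \<tau>) * \<phi> ((\<Sum>s\<le>t. hits_at w s) - cur w t) \<le> past w t"
proof (induction t)
  case 0
  have "counter (cfg w 0) = 0" using counter_le[of w 0] by simp
  then show ?case using \<phi>(1) by simp
next
  case (Suc t)
  let ?H = "\<Sum>s\<le>t. hits_at w s" and ?c = "counter (cfg w t)"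
  obtain d1 d2 r1 r2 where x: "w (Suc t) = (d1, d2, r1, r2)" by (metis prod_cases4)
  consider "counter (cfg w (Suc t)) = Suc ?c" | "counter (cfg w (Suc t)) = 0"
    by (cases "must (cfg w t) d1 d2") (auto simp: cfg_Suc[of w, OF x])
  then show ?case
  proof cases
    case 1
    then show ?thesis using Suc by simp
  next
    case 2
    define f where "f = (of_bool (?c + 1 = \<tau>) :: nat)"
    have ac: "0 \<le> a * cur w t" using a cur_nonneg by simp
    have H0: "0 \<le> ?H" by (intro sum_nonneg hit_nonneg)
    \<comment> \<open>A full epoch ending at \<open>t\<close> occupies exactly the \<tau> times from
      \<open>t - ?c\<close> to \<open>t\<close>; a short one adds nothing to the count.\<close>
    have e: "(t - ?c) div \<tau> + f \<le> Suc t div \<tau>"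
    proof (cases "?c + 1 = \<tau>")
      case True
      then have "Suc t = (t - ?c) + \<tau>" using counter_le[of w t] by simp
      then have "Suc t div \<tau> = ((t - ?c) + \<tau>) div \<tau>" by (rule arg_cong)
      also have "\<dots> = (t - ?c) div \<tau> + 1" using tau by (intro div_add_self2) simp
      finally show ?thesis using True by (simp add: f_def)
    qed (auto simp: f_def intro!: div_le_mono)
    have "(1 - \<beta>) ^ (Suc t div \<tau>) * \<phi> ?H \<le> (1 - \<beta>) ^ ((t - ?c) div \<tau> + f) * \<phi> ?H"
      using e \<beta> \<phi>(2) H0 by (intro mult_right_mono power_decreasing) auto
    also have "\<dots> \<le> (1 - \<beta>) ^ ((t - ?c) div \<tau> + f) * (\<phi> (?H - cur w t) * (1 + a * cur w t))"
      using \<phi>(3)[of "?H - cur w t" "cur w t"] Suc cur_nonneg[of w t] cur_le_tau[of w t] \<beta>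
      by (intro mult_left_mono) auto
    also have "\<dots> = ((1 - \<beta>) ^ ((t - ?c) div \<tau>) * \<phi> (?H - cur w t)) * ((1 - \<beta>) ^ f * (1 + a * cur w t))"
      by (simp add: power_add mult_ac)
    also have "\<dots> \<le> past w t * (1 + a * cur w t - \<beta> * of_bool (?c + 1 = \<tau>))"
    proof (intro mult_mono)
      show "(1 - \<beta>) ^ f * (1 + a * cur w t) \<le> 1 + a * cur w t - \<beta> * of_bool (?c + 1 = \<tau>)"
        using ac \<beta> mult_nonneg_nonneg[OF \<beta>(1) ac] by (auto simp: f_def algebra_simps)
      show "0 \<le> (1 - \<beta>) ^ f * (1 + a * cur w t)" using ac \<beta> by auto
    qed (use Suc past_nonneg in auto)
    finally show ?thesis using 2 H0 by simp
  qed
qed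

text \<open>The additional factor 1 - \<beta> pays for the running epoch, which may still become
  full; its future value is at least -\<beta>.\<close>

lemma potential_ge:
  fixes \<phi> :: "real \<Rightarrow> real"
  assumes \<phi>: "\<phi> 0 \<le> 1" "\<And>x. 0 \<le> x \<Longrightarrow> 0 \<le> \<phi> x"
    "\<And>x y. 0 \<le> x \<Longrightarrow> 0 \<le> y \<Longrightarrow> y \<le> real \<tau> \<Longrightarrow> \<phi> (x + y) \<le> \<phi> x * (1 + a * y)"
  shows "(1 - \<beta>) ^ (t div \<tau> + 1) * \<phi> (\<Sum>s\<le>t. hits_at w s) \<le> potential w t"
proof -
  let ?H = "\<Sum>s\<le>t. hits_at w s" and ?c = "counter (cfg w t)"
  have ac: "0 \<le> a * cur w t" using a cur_nonneg by simp
  have H0: "0 \<le> ?H" by (intro sum_nonneg hit_nonneg)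
  have past: "0 \<le> ?H - cur w t" "(1 - \<beta>) ^ ((t - ?c) div \<tau>) * \<phi> (?H - cur w t) \<le> past w t"
  proof -
    have "0 \<le> ?H - cur w t \<and> (1 - \<beta>) ^ ((t - ?c) div \<tau>) * \<phi> (?H - cur w t) \<le> past w t"
      using \<phi> by (rule past_ge)
    then show "0 \<le> ?H - cur w t" "(1 - \<beta>) ^ ((t - ?c) div \<tau>) * \<phi> (?H - cur w t) \<le> past w t"
      by blast+
  qed
  have "(1 - \<beta>) ^ (t div \<tau> + 1) * \<phi> ?H \<le> (1 - \<beta>) ^ ((t - ?c) div \<tau> + 1) * \<phi> ?H"
    using \<beta> \<phi>(2)[OF H0] div_le_mono[of "t - ?c" t \<tau>]
    by (intro mult_right_mono power_decreasing) auto
  also have "\<dots> \<le> (1 - \<beta>) ^ ((t - ?c) div \<tau> + 1) * (\<phi> (?H - cur w t) * (1 + a * cur w t))"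
    using \<phi>(3)[of "?H - cur w t" "cur w t"] past cur_nonneg[of w t] cur_le_tau[of w t] \<beta>
    by (intro mult_left_mono) auto
  also have "\<dots> = ((1 - \<beta>) ^ ((t - ?c) div \<tau>) * \<phi> (?H - cur w t)) * ((1 - \<beta>) * (1 + a * cur w t))"
    by (simp add: mult_ac)
  also have "\<dots> \<le> past w t * (1 + a * cur w t
     + hit_value a \<beta> (bset h p w t) (\<tau> - 1 - counter (cfg w t)) (cfg w t))"
  proof (intro mult_mono past past_nonneg)
    show "(1 - \<beta>) * (1 + a * cur w t) \<le> 1 + a * cur w t
     + hit_value a \<beta> (bset h p w t) (\<tau> - 1 - counter (cfg w t)) (cfg w t)"
      using hit_value_ge[OF a \<beta>(1), of "bset h p w t" "\<tau> - 1 - counter (cfg w t)" "cfg w t"]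
        mult_nonneg_nonneg[OF \<beta>(1) ac] by (simp add: algebra_simps)
    show "0 \<le> (1 - \<beta>) * (1 + a * cur w t)" using ac \<beta> by auto
  qed
  finally show ?thesis by (simp add: potential_def)
qed

text \<open>While an epoch runs, the recursion of \<open>hit_value\<close> balances the potential
  exactly. At a restart the finished factor passes into \<open>past\<close>, and the factor of the
  new epoch has mean at most 1 by \<open>avg_start_le_0\<close>.\<close>

lemma potential_supermartingale:
  assumes "long_epochs" "a * \<tau> * p\<^sup>2 \<le> 0.9 * \<beta>"
  shows "avg (seqs seeds (Suc t)) (\<lambda>w. potential w t) \<le> 1"
proof -
  \<comment> \<open>The shift by one is needed because the potential at time \<open>t\<close>
    already uses the seed at \<open>t\<close>, that is, \<open>t + 1\<close> coordinates.\<close>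
  define \<Phi> where "\<Phi> t w = (if t = 0 then 1 else potential w (t - 1))" for t w
  have start: "avg E (\<lambda>r1. avg E (\<lambda>r2. a * hit (bset h p v s) (start_config r1 r2)
           + hit_value a \<beta> (bset h p v s) (\<tau> - 1) (start_config r1 r2))) \<le> 0" for v s
    by (rule avg_start_le_0[OF assms(1) a \<beta>(1) p card_bset[OF p] assms(2)])
  have avg_E_affine: "avg E (\<lambda>r1. avg E (\<lambda>r2. y * (1 + f r1 r2))) = y * (1 + avg E (\<lambda>r1. avg E (\<lambda>r2. f r1 r2)))"
    for y and f :: "'v \<times> 'v \<Rightarrow> 'v \<times> 'v \<Rightarrow> real"
    using finite_E E_nonempty by (simp only: avg_cmult avg_add avg_const not_False_eq_True)
  have avg_D_affine: "avg D (\<lambda>d1. avg D (\<lambda>d2. y * (z + f d1 d2))) = y * (z + avg D (\<lambda>d1. avg D (\<lambda>d2. f d1 d2)))"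
    for y z and f :: "nat \<Rightarrow> nat \<Rightarrow> real"
    using D_nonempty by (simp only: avg_cmult avg_add avg_const finite_atLeastAtMost not_False_eq_True)
  have "avg (seqs seeds (Suc t)) (\<Phi> (Suc t)) \<le> \<Phi> 0 (\<lambda>_. undefined)"
  proof (rule avg_supermartingale)
    fix t and w :: "nat \<Rightarrow> 'v seed"
    show "avg seeds (\<lambda>x. \<Phi> (Suc t) (w(t := x))) \<le> \<Phi> t w"
    proof (cases t)
      case 0
      define B where "B = bset h p w 0"
      have "\<Phi> (Suc t) (w(t := (d1, d2, r1, r2))) = 1 * (1 + (a * hit B (start_config r1 r2)
           + hit_value a \<beta> B (\<tau> - 1) (start_config r1 r2)))" for d1 d2 r1 r2
      proof -
        let ?u = "w(t := (d1, d2, r1, r2))"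
        have cfg: "cfg ?u 0 = start_config r1 r2" using 0 by (simp add: config_at.simps)
        moreover have "counter (cfg w 0) = 0" using counter_le[of w 0] by simp
        ultimately have "bset h p ?u 0 = B"
          by (simp add: bset_def B_def epoch_start_def heavy_def)
        then show ?thesis using cfg 0 by (simp add: \<Phi>_def potential_def)
      qed
      then have "avg seeds (\<lambda>x. \<Phi> (Suc t) (w(t := x))) =
          1 * (1 + avg E (\<lambda>r1. avg E (\<lambda>r2. a * hit B (start_config r1 r2)
           + hit_value a \<beta> B (\<tau> - 1) (start_config r1 r2))))"
        unfolding avg_seeds by (simp only: avg_E_affine) (use D_nonempty in \<open>simp add: avg_const\<close>)
      also have "\<dots> \<le> 1" using start[of w 0] by (simp add: B_def)
      finally show ?thesis by (simp add: \<Phi>_def 0)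
    next
      case (Suc t')
      define s where "s = cfg w t'"
      define r where "r = \<tau> - 1 - counter s"
      define B where "B = bset h p w t'"
      define A where "A = heavy h w t"
      \<comment> \<open>The heavy set of an epoch starting at \<open>t\<close>. It is determined by
        the seeds before \<open>t\<close>, hence independent of the fresh arcs drawn at
        \<open>t\<close>.\<close>
      define B' where "B' = (if real (card A) \<le> p * real (card V) then A else {})"
      define P where "P = past w t'"
      define C where "C = 1 + a * cur w t'"
      have r: "counter s + r + 1 = \<tau>" using counter_less[of w t'] by (simp add: r_def s_def)
      have cardB': "real (card (V \<inter> B')) \<le> p * real (card V)"
      proof -
        have "card (V \<inter> B') \<le> card B'"
          by (intro card_mono) (auto simp: B'_def A_def finite_heavy)
        moreover have "real (card B') \<le> p * real (card V)" using p by (auto simp: B'_def)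
        ultimately show ?thesis by linarith
      qed
      have startB': "avg E (\<lambda>r1. avg E (\<lambda>r2. a * hit B' (start_config r1 r2)
           + hit_value a \<beta> B' (\<tau> - 1) (start_config r1 r2))) \<le> 0"
        by (rule avg_start_le_0[OF assms(1) a \<beta>(1) p cardB' assms(2)])
      define F where "F d1 d2 r1 r2 = (if must s d1 d2
        then (P * (C - \<beta> * of_bool (r = 0))) * (1 + (a * hit B' (start_config r1 r2)
           + hit_value a \<beta> B' (\<tau> - 1) (start_config r1 r2)))
        else P * (C + (a * hit B (move s d1 d2) + hit_value a \<beta> B (r - 1) (move s d1 d2))))"
        for d1 d2 r1 r2
      have F: "\<Phi> (Suc t) (w(t := (d1, d2, r1, r2))) = F d1 d2 r1 r2" for d1 d2 r1 r2
      proof -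
        let ?u = "w(t := (d1, d2, r1, r2))"
        have old: "cfg ?u t' = s" "cur ?u t' = cur w t'" "past ?u t' = P"
          using Suc cur_past_cong[of t' ?u w] unfolding s_def P_def
          by (auto intro!: cfg_cong)
        have new: "cfg ?u t = (if must s d1 d2 then start_config r1 r2 else move s d1 d2)"
          using cfg_Suc[of ?u t' d1 d2 r1 r2] Suc old by simp
        have hv: "heavy h ?u t = A" unfolding A_def by (intro heavy_cong) auto
        have st: "epoch_start w t' \<le> t'" by (simp add: epoch_start_def)
        show ?thesis
        proof (cases "must s d1 d2")
          case True
          then have cfg: "cfg ?u t = start_config r1 r2" by (simp add: new)
          then have "bset h p ?u t = B'"
            by (simp add: bset_def epoch_start_def hv B'_def)
          then show ?thesis
            using True cfg old r unfolding Suc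
            by (auto simp: \<Phi>_def potential_def F_def C_def algebra_simps)
        next
          case False
          then have cfg: "cfg ?u t = move s d1 d2" by (simp add: new)
          have "heavy h ?u (t' - counter s) = heavy h w (t' - counter s)"
            using Suc by (intro heavy_cong) auto
          then have "bset h p ?u t = B"
            using cfg Suc by (simp add: bset_def epoch_start_def B_def s_def[symmetric])
          moreover have "r \<noteq> 0" using False r by (auto simp: must_restart_def)
          ultimately show ?thesis
            using False cfg old r unfolding Suc
            by (auto simp: \<Phi>_def potential_def F_def C_def algebra_simps r_def)
        qed
      qed
      have P0: "0 \<le> P" by (simp add: P_def past_nonneg)
      have C1: "1 \<le> C" using a cur_nonneg by (simp add: C_def)
      have "avg seeds (\<lambda>x. \<Phi> (Suc t) (w(t := x))) =
          avg D (\<lambda>d1. avg D (\<lambda>d2. avg E (\<lambda>r1. avg E (\<lambda>r2. F d1 d2 r1 r2))))"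
        unfolding avg_seeds by (simp only: F)
      also have "\<dots> \<le> avg D (\<lambda>d1. avg D (\<lambda>d2. P * (C - \<beta> * of_bool (r = 0) + (if must s d1 d2 then 0
          else a * hit B (move s d1 d2) + hit_value a \<beta> B (r - 1) (move s d1 d2)))))"
      proof (intro avg_mono)
        fix d1 d2
        show "avg E (\<lambda>r1. avg E (\<lambda>r2. F d1 d2 r1 r2)) \<le> P * (C - \<beta> * of_bool (r = 0) +
          (if must s d1 d2 then 0 else a * hit B (move s d1 d2) + hit_value a \<beta> B (r - 1) (move s d1 d2)))"
        proof (cases "must s d1 d2")
          case True
          have "0 \<le> P * (C - \<beta> * of_bool (r = 0))" using P0 C1 \<beta> by auto
          then have "(P * (C - \<beta> * of_bool (r = 0))) * (1 + avg E (\<lambda>r1. avg E (\<lambda>r2. a * hit B' (start_config r1 r2)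
           + hit_value a \<beta> B' (\<tau> - 1) (start_config r1 r2)))) \<le> (P * (C - \<beta> * of_bool (r = 0))) * 1"
            using startB' by (intro mult_left_mono) auto
          then show ?thesis unfolding F_def using True by (simp only: if_True avg_E_affine) simp
        next
          case False
          then have "r \<noteq> 0" using r by (auto simp: must_restart_def)
          then show ?thesis unfolding F_def using False finite_E E_nonempty by (simp add: avg_const)
        qed
      qed
      \<comment> \<open>For \<open>r = 0\<close> every draw forces a restart and \<beta> is charged;
        for \<open>r > 0\<close> a restart comes from a collision and carries no charge. Both agree
        with the clauses of \<open>hit_value\<close>.\<close>
      also have "\<dots> = P * (C + hit_value a \<beta> B r s)"
      proof (cases r)
        case 0
        then have "must s d1 d2" for d1 d2 using r by (simp add: must_restart_def)
        then show ?thesis using 0 D_nonempty by (simp add: avg_const)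
      next
        case (Suc r')
        show ?thesis
          unfolding Suc by (simp only: avg_D_affine hit_value.simps of_bool_eq diff_0_right
              mult_zero_right nat.distinct diff_Suc_1)
      qed
      also have "\<dots> = \<Phi> t w"
        by (simp add: \<Phi>_def potential_def Suc P_def C_def B_def r_def s_def)
      finally show ?thesis .
    qed
  qed
  moreover have "\<Phi> (Suc t) = (\<lambda>w. potential w t)" by (simp add: \<Phi>_def fun_eq_iff)
  ultimately show ?thesis by (simp add: \<Phi>_def)
qed

text \<open>\<open>\<phi>\<close> bounds the product of the factors \<open>1 + a * y\<close> of the epochs by a function of the sum of the \<open>y\<close>.\<close>

lemma hits_tail:
  fixes \<phi> :: "real \<Rightarrow> real"
  assumes "long_epochs" "a * \<tau> * p\<^sup>2 \<le> 0.9 * \<beta>"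
    and \<phi>: "\<phi> 0 \<le> 1" "mono_on {0..} \<phi>" "\<And>x. 0 \<le> x \<Longrightarrow> 0 < \<phi> x"
    "\<And>x y. 0 \<le> x \<Longrightarrow> 0 \<le> y \<Longrightarrow> y \<le> real \<tau> \<Longrightarrow> \<phi> (x + y) \<le> \<phi> x * (1 + a * y)"
    and y: "0 \<le> y"
  shows "avg (seqs seeds (Suc t)) (\<lambda>w. of_bool (y \<le> (\<Sum>s\<le>t. hits_at w s)))
    \<le> 1 / ((1 - \<beta>) ^ (t div \<tau> + 1) * \<phi> y)"
proof (rule avg_markov[where f = "\<lambda>w. potential w t"])
  have \<phi>': "0 \<le> \<phi> x" if "0 \<le> x" for x using \<phi>(3)[OF that] by simp
  have ge: "(1 - \<beta>) ^ (t div \<tau> + 1) * \<phi> (\<Sum>s\<le>t. hits_at w s) \<le> potential w t" for w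
    using \<phi>(1) \<phi>' \<phi>(4) by (rule potential_ge)
  show "finite (seqs seeds (Suc t))" using finite_seeds by (auto intro: finite_PiE)
  show "avg (seqs seeds (Suc t)) (\<lambda>w. potential w t) \<le> 1"
    using assms by (intro potential_supermartingale)
  show "0 < (1 - \<beta>) ^ (t div \<tau> + 1) * \<phi> y" using \<phi>(3)[OF y] \<beta> by simp
  show "0 \<le> potential w t" for w
  proof -
    have "0 \<le> (\<Sum>s\<le>t. hits_at w s)" by (intro sum_nonneg hit_nonneg)
    then have "0 \<le> (1 - \<beta>) ^ (t div \<tau> + 1) * \<phi> (\<Sum>s\<le>t. hits_at w s)"
      using \<phi>(3) \<beta> by (auto intro: less_imp_le)
    with ge[of w] show ?thesis by linarith
  qed
  show "(1 - \<beta>) ^ (t div \<tau> + 1) * \<phi> y \<le> potential w t" if "y \<le> (\<Sum>s\<le>t. hits_at w s)" for w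
  proof -
    have "\<phi> y \<le> \<phi> (\<Sum>s\<le>t. hits_at w s)"
      using \<phi>(2) y that by (auto simp: mono_on_def)
    then have "(1 - \<beta>) ^ (t div \<tau> + 1) * \<phi> y \<le> (1 - \<beta>) ^ (t div \<tau> + 1) * \<phi> (\<Sum>s\<le>t. hits_at w s)"
      using \<beta> by (intro mult_left_mono) auto
    with ge[of w] show ?thesis by linarith
  qed
qed

end

end

end

section \<open>From one load level to the next\<close>

text \<open>By convexity, 2^u lies below its chord on [0, 1].\<close>

lemma two_powr_le: "2 powr u \<le> 1 + u" if "0 \<le> u" "u \<le> 1" for u :: real
proof -
  have "exp ((1 - u) *\<^sub>R 0 + u *\<^sub>R ln 2) \<le> (1 - u) * exp 0 + u * exp (ln 2)"
    using that by (intro convex_onD[OF exp_convex]) auto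
  then show ?thesis by (simp add: powr_def)
qed

text \<open>By convexity, 4^(-b) lies below its chord on [0, 1/2], which runs from 1 to 1/2.\<close>

lemma two_powr_minus_le: "2 powr (- 2 * b) \<le> 1 - b" if "0 \<le> b" "b \<le> 1/2" for b :: real
proof -
  have "exp ((1 - 2 * b) *\<^sub>R 0 + (2 * b) *\<^sub>R (- ln 2)) \<le> (1 - 2 * b) * exp 0 + (2 * b) * exp (- ln 2)"
    using that by (intro convex_onD[OF exp_convex]) auto
  then show ?thesis by (simp add: powr_def exp_minus)
qed

lemma half_power_two_power: "(1 / 2 :: real) ^ (2 ^ Suc i) = ((1 / 2) ^ (2 ^ i))\<^sup>2"
  by (simp add: power_mult[symmetric] mult.commute)

context scheme
begin

abbreviation "n \<equiv> card V"

lemma n_pos: "0 < n"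
  using finite_V nonempty by (simp add: card_gt_0_iff)

text \<open>With the strict comparison, \<open>bad h (1 / h)\<close> vanishes, and for nonnegative
  \<open>p\<close> with \<open>p * n < 1\<close> the event says that some bin has load at least
  \<open>h\<close>.\<close>

definition bad :: "nat \<Rightarrow> real \<Rightarrow> real" where
  "bad h p = avg (seqs seeds n) (\<lambda>w. of_bool (p * real n < real (card (heavy h w n))))"

text \<open>Either level \<open>h\<close> already has too many heavy bins, or \<open>bset\<close> is
  never emptied and the bins of level \<open>Suc h\<close> are bounded by the hits, whose tail is
  \<open>hits_tail\<close>. The parameter \<open>z\<close> is any convenient lower bound for the
  Markov denominator.\<close>

lemma bad_Suc_le:
  fixes \<phi> :: "real \<Rightarrow> real" and a \<beta> p p' z :: real
  assumes "long_epochs" "0 \<le> a" "0 \<le> \<beta>" "\<beta> \<le> 1/2" "0 \<le> p" "0 \<le> p'"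
    and "a * \<tau> * p\<^sup>2 \<le> 0.9 * \<beta>"
    and \<phi>: "\<phi> 0 \<le> 1" "mono_on {0..} \<phi>" "\<And>x. 0 \<le> x \<Longrightarrow> 0 < \<phi> x"
    "\<And>x y. 0 \<le> x \<Longrightarrow> 0 \<le> y \<Longrightarrow> y \<le> real \<tau> \<Longrightarrow> \<phi> (x + y) \<le> \<phi> x * (1 + a * y)"
    and z: "0 < z" "z \<le> (1 - \<beta>) ^ (n div \<tau> + 1) * \<phi> (p' * n)"
  shows "bad (Suc h) p' \<le> bad h p + 1 / z"
proof -
  obtain t where t: "n = Suc t" using n_pos by (cases n) auto
  let ?H = "\<lambda>w. \<Sum>s\<le>t. hit (bset h p w s) (cfg w s)"
  have pos: "0 < \<phi> (p' * n)" using \<phi>(3) assms(6) by simp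
  have "bad (Suc h) p' \<le> avg (seqs seeds n) (\<lambda>w. of_bool (p * real n < real (card (heavy h w n)))
      + of_bool (p' * real n \<le> ?H w))"
    unfolding bad_def
  proof (rule avg_mono)
    fix w assume w: "w \<in> seqs seeds n"
    show "of_bool (p' * real n < real (card (heavy (Suc h) w n))) \<le>
      (of_bool (p * real n < real (card (heavy h w n))) + of_bool (p' * real n \<le> ?H w) :: real)"
    proof (cases "p * real n < real (card (heavy h w n))")
      case False
      have "w i \<in> seeds" if "i < n" for i using PiE_mem[OF w, of i] that by simp
      then have "real (card (heavy (Suc h) w n)) \<le> (\<Sum>s<n. hit (bset h p w s) (cfg w s))"
        using False by (intro card_heavy_le_hits[OF order_refl]) auto
      then show ?thesis using False unfolding t lessThan_Suc_atMost by auto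
    qed auto
  qed
  also have "\<dots> = bad h p + avg (seqs seeds (Suc t)) (\<lambda>w. of_bool (p' * real n \<le> ?H w))"
    by (simp only: avg_add bad_def t)
  also have "avg (seqs seeds (Suc t)) (\<lambda>w. of_bool (p' * real n \<le> ?H w))
      \<le> 1 / ((1 - \<beta>) ^ (t div \<tau> + 1) * \<phi> (p' * real n))"
    using assms(2-5,1,7) \<phi> by (rule hits_tail) (simp_all add: assms(6))
  also have "\<dots> \<le> 1 / z"
  proof (intro divide_left_mono)
    \<comment> \<open>The last ball falls at time \<open>t = n - 1\<close>; passing to
      \<open>n\<close> in the exponent only weakens the bound.\<close>
    have "(1 - \<beta>) ^ (n div \<tau> + 1) \<le> (1 - \<beta>) ^ (t div \<tau> + 1)"
      using assms(3,4) div_le_mono[of t n \<tau>] t by (intro power_decreasing) auto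
    then have "(1 - \<beta>) ^ (n div \<tau> + 1) * \<phi> (p' * n) \<le> (1 - \<beta>) ^ (t div \<tau> + 1) * \<phi> (p' * n)"
      using pos by (intro mult_right_mono) auto
    then show "z \<le> (1 - \<beta>) ^ (t div \<tau> + 1) * \<phi> (p' * n)" using z by simp
    then show "0 < (1 - \<beta>) ^ (t div \<tau> + 1) * \<phi> (p' * n) * z"
      using z by (rule_tac mult_pos_pos; linarith)
  qed simp
  finally show ?thesis by simp
qed

lemma epochs_le: "real (n div \<tau> + 1) * real \<tau> \<le> real n + real \<tau>"
proof -
  have "n div \<tau> * \<tau> \<le> n" by simp
  then have "real (n div \<tau> * \<tau>) \<le> real n" by (rule of_nat_mono)
  then show ?thesis by (simp add: distrib_right)
qed

text \<open>Here a = 1/\<tau>, \<beta> = 2 p^2 and \<phi>(x) = 2^(x/\<tau>). With m at most 2 n /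
  \<tau>, the charge (1 - 2 p^2)^m is at least 2^(-4 p^2 m), hence at least 2^(-8 p^2 n / \<tau>),
  which is half the exponent gained from 16 p^2 n hits.\<close>

lemma bad_Suc_le_square:
  assumes "long_epochs" "\<tau> \<le> n" "0 \<le> p" "p \<le> 1/2"
  shows "bad (Suc h) (16 * p\<^sup>2) \<le> bad h p + 2 powr (- 8 * p\<^sup>2 * (n / \<tau>))"
proof -
  define m where "m = n div \<tau> + 1"
  have tau0: "0 < real \<tau>" using tau by simp
  have p2: "p\<^sup>2 \<le> (1/2)\<^sup>2" using assms by (intro power_mono) auto
  have "real m * real \<tau> \<le> 2 * n" using epochs_le assms(2) by (simp add: m_def)
  then have m: "real m \<le> 2 * (n / \<tau>)" using tau0 by (simp add: field_simps)
  have "4 * p\<^sup>2 * m \<le> 4 * p\<^sup>2 * (2 * (n / \<tau>))" using m by (intro mult_left_mono) auto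
  moreover have "16 * p\<^sup>2 * n / \<tau> = 2 * (4 * p\<^sup>2 * (2 * (n / \<tau>)))" by simp
  ultimately have "8 * p\<^sup>2 * (n / \<tau>) \<le> (- 2 * (2 * p\<^sup>2)) * m + 16 * p\<^sup>2 * n / \<tau>"
    by linarith
  then have "2 powr (8 * p\<^sup>2 * (n / \<tau>)) \<le> 2 powr ((- 2 * (2 * p\<^sup>2)) * m + 16 * p\<^sup>2 * n / \<tau>)"
    by (intro powr_mono) auto
  also have "\<dots> = (2 powr (- 2 * (2 * p\<^sup>2))) ^ m * 2 powr (16 * p\<^sup>2 * n / \<tau>)"
    unfolding powr_add by (subst powr_realpow[symmetric]) (auto simp: powr_powr)
  also have "\<dots> \<le> (1 - 2 * p\<^sup>2) ^ m * 2 powr (16 * p\<^sup>2 * n / \<tau>)"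
    using p2 by (intro mult_right_mono power_mono two_powr_minus_le) (auto simp: power2_eq_square)
  finally have z: "2 powr (8 * p\<^sup>2 * (n / \<tau>)) \<le> (1 - 2 * p\<^sup>2) ^ m * 2 powr (16 * p\<^sup>2 * n / \<tau>)" .
  have "bad (Suc h) (16 * p\<^sup>2) \<le> bad h p + 1 / 2 powr (8 * p\<^sup>2 * (n / \<tau>))"
  proof (rule bad_Suc_le[where a = "1 / \<tau>" and \<beta> = "2 * p\<^sup>2" and \<phi> = "\<lambda>x. 2 powr (x / \<tau>)"])
    show "2 powr (8 * p\<^sup>2 * (n / \<tau>)) \<le> (1 - 2 * p\<^sup>2) ^ (n div \<tau> + 1) * 2 powr (16 * p\<^sup>2 * n / \<tau>)"
      using z by (simp only: m_def)
    show "mono_on {0..} (\<lambda>x. 2 powr (x / real \<tau>))"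
      by (auto simp: mono_on_def intro!: divide_right_mono)
    fix x y :: real assume "0 \<le> x" "0 \<le> y" "y \<le> \<tau>"
    then show "2 powr ((x + y) / \<tau>) \<le> 2 powr (x / \<tau>) * (1 + 1 / \<tau> * y)"
      using two_powr_le[of "y / \<tau>"] tau0 by (simp add: add_divide_distrib powr_add)
  qed (use assms p2 tau0 in \<open>auto simp: power2_eq_square\<close>)
  then show ?thesis by (simp add: powr_minus_divide)
qed

text \<open>With the affine \<phi>(x) = 1 + a x this is in effect a first moment bound on the number
  of hits, so it needs no lower bound on p^2 n / \<tau>.\<close>

lemma bad_Suc_le_powr:
  assumes "long_epochs" "\<tau> \<le> n" "0 < p"
  shows "bad (Suc h) (p powr 1.5) \<le> bad h p + 16 * sqrt p"
proof -
  \<comment> \<open>This makes \<beta> equal to \<tau> / (2 (n + \<tau>)), so that m \<beta> is at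
    most 1/2 and, by Bernoulli, all charges together cost at most a factor 2.\<close>
  define a where "a = 1 / (4 * p\<^sup>2 * (real n + real \<tau>))"
  define \<beta> where "\<beta> = 2 * a * p\<^sup>2 * \<tau>"
  define m where "m = n div \<tau> + 1"
  have tau0: "0 < real \<tau>" and n0: "0 < real n" using tau n_pos by auto
  have a0: "0 < a" using assms tau0 by (simp add: a_def)
  have "\<beta> = ((2 * p\<^sup>2) * \<tau>) / ((2 * p\<^sup>2) * (2 * (real n + real \<tau>)))"
    by (simp add: \<beta>_def a_def mult_ac)
  then have \<beta>: "\<beta> = \<tau> / (2 * (real n + real \<tau>))"
    using assms(3) by (subst (asm) mult_divide_mult_cancel_left) auto
  have \<beta>0: "0 \<le> \<beta>" "\<beta> \<le> 1/2" unfolding \<beta> using tau0 by (auto simp: field_simps)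
  have "m * \<beta> = (real m * real \<tau>) / (2 * (real n + real \<tau>))" by (simp add: \<beta>)
  also have "\<dots> \<le> (real n + real \<tau>) / (2 * (real n + real \<tau>))"
    unfolding m_def by (rule divide_right_mono[OF epochs_le]) simp
  also have "\<dots> = 1/2" using tau0 by simp
  finally have "1 / 2 \<le> 1 - m * \<beta>" by simp
  also have "\<dots> \<le> (1 - \<beta>) ^ m" using Bernoulli_inequality[of "- \<beta>" m] \<beta>0 by simp
  finally have half: "1 / 2 \<le> (1 - \<beta>) ^ m" .
  have p15: "p powr 1.5 * sqrt p = p\<^sup>2"
    using assms(3) by (simp add: powr_half_sqrt[symmetric] powr_add[symmetric] powr_numeral)
  have "1 / (16 * sqrt p) = p powr 1.5 / (16 * p\<^sup>2)"
    using assms(3) unfolding p15[symmetric] by simp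
  also have "\<dots> = 1 / 2 * (p powr 1.5 * n / (4 * p\<^sup>2 * (2 * n)))"
    using n0 assms(3) nonempty finite_V by (simp add: field_simps)
  also have "\<dots> \<le> 1 / 2 * (p powr 1.5 * n / (4 * p\<^sup>2 * (real n + real \<tau>)))"
    using assms n0 tau0 by (intro mult_left_mono divide_left_mono mult_pos_pos) auto
  also have "\<dots> = 1 / 2 * (a * (p powr 1.5 * n))" by (simp add: a_def)
  also have "\<dots> \<le> 1 / 2 * (1 + a * (p powr 1.5 * n))" by simp
  also have "\<dots> \<le> (1 - \<beta>) ^ m * (1 + a * (p powr 1.5 * n))"
    using half a0 by (intro mult_right_mono) auto
  finally have z: "1 / (16 * sqrt p) \<le> (1 - \<beta>) ^ m * (1 + a * (p powr 1.5 * n))" .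
  have "bad (Suc h) (p powr 1.5) \<le> bad h p + 1 / (1 / (16 * sqrt p))"
  proof (rule bad_Suc_le[where a = a and \<beta> = \<beta> and \<phi> = "\<lambda>x. 1 + a * x"])
    show "1 / (16 * sqrt p) \<le> (1 - \<beta>) ^ (n div \<tau> + 1) * (1 + a * (p powr 1.5 * n))"
      using z by (simp only: m_def)
    show "mono_on {0..} (\<lambda>x. 1 + a * x)"
      using a0 by (auto simp: mono_on_def)
    show "0 < 1 + a * x" if "0 \<le> x" for x
      using a0 that by (intro add_pos_nonneg) auto
    show "1 + a * (x + y) \<le> (1 + a * x) * (1 + a * y)" if "0 \<le> x" "0 \<le> y" for x y
      using a0 that by (simp add: algebra_simps)
    show "a * \<tau> * p\<^sup>2 \<le> 0.9 * \<beta>"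
    proof -
      have "0 \<le> a * \<tau> * p\<^sup>2" using a0 by simp
      then show ?thesis by (simp add: \<beta>_def)
    qed
  qed (use assms \<beta>0 a0 in auto)
  then show ?thesis by simp
qed

lemma bad_start: "0 < h \<Longrightarrow> bad h (1 / h) = 0"
proof -
  assume h: "0 < h"
  have "of_bool (1 / h * real n < real (card (heavy h w n))) = (0 :: real)" if w: "w \<in> seqs seeds n" for w
  proof -
    have "w i \<in> seeds" if "i < n" for i using PiE_mem[OF w, of i] that by simp
    then have "h * card (heavy h w n) \<le> n" by (rule card_heavy_start)
    then have "real h * real (card (heavy h w n)) \<le> real n" by (metis of_nat_le_iff of_nat_mult)
    then show ?thesis using h by (simp add: field_simps)
  qed
  then show ?thesis by (simp add: bad_def avg_def)
qed

text \<open>The scaling by 1/16 turns p -> 16 p^2 into plain squaring, and \<open>q 0 = 1/32\<close>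
  matches \<open>bad_start\<close> at load 32.\<close>

lemma bad_iterate_square:
  assumes "long_epochs" "\<tau> \<le> n"
  defines "q \<equiv> \<lambda>i::nat. (1/16) * (1/2 :: real) ^ (2 ^ i)"
  shows "bad (32 + i) (q i) \<le> i * 2 powr (- 8 * (q i)\<^sup>2 * (n / \<tau>))"
proof (induction i)
  case 0
  show ?case using bad_start[of 32] by (simp add: q_def)
next
  case (Suc i)
  have q0: "0 \<le> q i" for i by (simp add: q_def)
  have mono: "q (Suc i) \<le> q i" unfolding q_def by (rule mult_left_mono[OF power_decreasing]) auto
  have "q i \<le> 1/16 * 1" unfolding q_def by (intro mult_left_mono power_le_one) auto
  then have "bad (Suc (32 + i)) (16 * (q i)\<^sup>2) \<le> bad (32 + i) (q i) + 2 powr (- 8 * (q i)\<^sup>2 * (n / \<tau>))"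
    using q0 by (intro bad_Suc_le_square assms) auto
  also have "16 * (q i)\<^sup>2 = q (Suc i)"
    by (simp only: q_def half_power_two_power power_mult_distrib) (simp add: power2_eq_square)
  also have "bad (32 + i) (q i) + 2 powr (- 8 * (q i)\<^sup>2 * (n / \<tau>)) \<le>
      real (Suc i) * 2 powr (- 8 * (q i)\<^sup>2 * (n / \<tau>))"
    using Suc by (simp add: distrib_right)
  \<comment> \<open>The errors grow as \<open>q\<close> shrinks, so all the earlier ones are bounded
    by the latest.\<close>
  also have "\<dots> \<le> real (Suc i) * 2 powr (- 8 * (q (Suc i))\<^sup>2 * (n / \<tau>))"
  proof -
    have "(q (Suc i))\<^sup>2 * (n / \<tau>) \<le> (q i)\<^sup>2 * (n / \<tau>)"
      using mono q0 by (intro mult_right_mono power_mono) auto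
    then show ?thesis by (intro mult_left_mono powr_mono) auto
  qed
  finally show ?case by simp
qed

text \<open>Each round multiplies the exponent of p by 3/2; the fractions decrease, so every round
  has error at most that of the first.\<close>

lemma bad_iterate_powr:
  assumes "long_epochs" "\<tau> \<le> n" "0 < p" "p \<le> 1"
  shows "bad (h + j) (p powr (1.5 ^ j)) \<le> bad h p + 16 * real j * sqrt p"
proof (induction j)
  case 0
  show ?case using assms by simp
next
  case (Suc j)
  define q where "q = p powr (1.5 ^ j)"
  have "q \<le> p powr 1" unfolding q_def using assms(3,4) by (intro powr_mono') auto
  then have q: "0 < q" "q \<le> p" using assms(3) by (auto simp: q_def)
  have "bad (Suc (h + j)) (q powr 1.5) \<le> bad (h + j) q + 16 * sqrt q"
    using q by (intro bad_Suc_le_powr assms)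
  also have "\<dots> \<le> bad h p + 16 * real j * sqrt p + 16 * sqrt p"
    using Suc q by (intro add_mono) (auto simp: q_def)
  finally show ?case by (simp add: q_def powr_powr mult.commute algebra_simps)
qed

text \<open>Once the final fraction times n is below 1, a single bin of load
  \<open>32 + i + j\<close> already belongs to the bad event.\<close>

lemma max_load_bound:
  assumes "long_epochs" "\<tau> \<le> n"
    and "((1/16) * (1/2 :: real) ^ (2 ^ i)) powr (1.5 ^ j) * n < 1"
  shows "1 - (i * 2 powr (- (1 / 32) * (1/2) ^ (2 ^ Suc i) * (n / \<tau>)) + 16 * real j * sqrt ((1/2) ^ (2 ^ i)))
    \<le> measure (seed_space k G) {w \<in> space (seed_space k G). max_load G ord \<tau> tie w < 32 + i + j}"
proof -
  define q where "q = (1/16) * (1/2 :: real) ^ (2 ^ i)"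
  define h where "h = 32 + i + j"
  have q: "0 < q" "q \<le> 1/16 * 1" "q \<le> (1/2) ^ (2 ^ i)"
    unfolding q_def by (auto intro!: mult_left_mono power_le_one)
  have q2: "8 * q\<^sup>2 = (1 / 32) * (1/2) ^ (2 ^ Suc i)"
    by (simp only: q_def half_power_two_power power_mult_distrib) (simp add: power2_eq_square)
  have cong: "(max_load G ord \<tau> tie w < h) = (max_load G ord \<tau> tie w' < h)"
    if "\<And>i. i < n \<Longrightarrow> w i = w' i" for w w'
    unfolding max_load_def using ld_cong[of n w w'] that by simp
  have "avg (seqs seeds n) (\<lambda>w. of_bool (max_load G ord \<tau> tie w < h) + of_bool (\<not> max_load G ord \<tau> tie w < h)) = 1"
  proof -
    have "(\<lambda>w. of_bool (max_load G ord \<tau> tie w < h) + of_bool (\<not> max_load G ord \<tau> tie w < h)) = (\<lambda>w. 1 :: real)"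
      by auto
    moreover have "finite (seqs seeds n)" "seqs seeds n \<noteq> {}"
      using finite_seeds seeds_nonempty by (auto intro: finite_PiE simp: PiE_eq_empty_iff)
    ultimately show ?thesis by (simp add: avg_const)
  qed
  then have "1 - avg (seqs seeds n) (\<lambda>w. of_bool (\<not> max_load G ord \<tau> tie w < h)) =
      avg (seqs seeds n) (\<lambda>w. of_bool (max_load G ord \<tau> tie w < h))"
    by (simp only: avg_add)
  also have "\<dots> = measure (seed_space k G) {w \<in> space (seed_space k G). max_load G ord \<tau> tie w < h}"
    by (rule measure_seed_event[OF cong, symmetric])
  finally have *: "1 - avg (seqs seeds n) (\<lambda>w. of_bool (\<not> max_load G ord \<tau> tie w < h)) = \<dots>" .
  have "avg (seqs seeds n) (\<lambda>w. of_bool (\<not> max_load G ord \<tau> tie w < h)) \<le> bad h (q powr (1.5 ^ j))"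
    unfolding bad_def
  proof (rule avg_mono)
    fix w
    show "of_bool (\<not> max_load G ord \<tau> tie w < h) \<le>
      (of_bool (q powr (1.5 ^ j) * real n < real (card (heavy h w n))) :: real)"
    proof (cases "max_load G ord \<tau> tie w < h")
      case False
      have "max_load G ord \<tau> tie w \<in> ld w n ` V"
        unfolding max_load_def using finite_V nonempty by (intro Max_in) auto
      with False have "heavy h w n \<noteq> {}" by (auto simp: heavy_def not_less)
      then have "1 \<le> card (heavy h w n)" using finite_heavy by (simp add: Suc_le_eq card_gt_0_iff)
      then show ?thesis using assms(3) by (simp add: q_def)
    qed simp
  qed
  also have "\<dots> \<le> bad (32 + i) q + 16 * real j * sqrt q"
    unfolding h_def using q by (intro bad_iterate_powr assms) auto
  also have "\<dots> \<le> i * 2 powr (- 8 * q\<^sup>2 * (n / \<tau>)) + 16 * real j * sqrt ((1/2) ^ (2 ^ i))"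
    using bad_iterate_square[OF assms(1,2), of i] q by (intro add_mono mult_left_mono) (auto simp: q_def)
  finally show ?thesis unfolding *[symmetric] h_def[symmetric] using q2 by simp
qed

section \<open>Asymptotics\<close>

lemma max_load_tail:
  fixes \<alpha> :: real and j :: nat
  assumes "long_epochs" and \<alpha>: "0 < \<alpha>" "\<alpha> < 1"
    and \<tau>_le: "real \<tau> \<le> real n powr (1 - \<alpha> / 2)"
    and large: "8 \<le> \<alpha> * ln (real n)"
    and j: "1 < \<alpha> / 16 * ln 2 * 1.5 ^ j"
  shows "1 - (ln n * 2 powr (- (1 / 32) * real n powr (\<alpha> / 4)) + 16 * real j * real n powr (- (\<alpha> * ln 2 / 32)))
    \<le> measure (seed_space k G) {w \<in> space (seed_space k G).
        real (max_load G ord \<tau> tie w) < log 2 (ln n) + (32 + real j)}"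
proof -
  define L where "L = ln (real n)"
  \<comment> \<open>The choice puts 2^i between \<alpha> L / 16 and \<alpha> L / 8. The upper bound
    keeps p^2 n / \<tau> at least of order n^(\<alpha>/4), given n / \<tau> at least n^(\<alpha>/2);
    the lower one makes p a negative power of n.\<close>
  define i where "i = nat \<lfloor>log 2 (\<alpha> / 8 * L)\<rfloor>"
  have L8: "8 \<le> \<alpha> * L" using large by (simp add: L_def)
  have "0 < L" using L8 \<alpha> by (intro zero_less_mult_pos[of \<alpha> L]) auto
  then have "\<alpha> * L \<le> 1 * L" using \<alpha> by (intro mult_right_mono) auto
  then have L: "8 \<le> L" using L8 by simp
  then have n: "1 < real n" unfolding L_def using n_pos by (metis ln_gt_zero_iff less_le_trans of_nat_0_less_iff zero_less_numeral)
  have expL: "n powr x = exp (x * L)" for x using n nonempty finite_V by (simp add: powr_def L_def)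
  have "0 \<le> log 2 (\<alpha> / 8 * L)" using L8 by simp
  then have i: "real i \<le> log 2 (\<alpha> / 8 * L)" "log 2 (\<alpha> / 8 * L) < real i + 1"
    unfolding i_def by linarith+
  have "2 powr real i \<le> 2 powr log 2 (\<alpha> / 8 * L)" using i by (intro powr_mono) auto
  then have i1: "2 ^ i \<le> \<alpha> / 8 * L" using L8 by (simp add: powr_realpow)
  have "2 powr log 2 (\<alpha> / 8 * L) < 2 powr (real i + 1)" using i by (intro powr_less_mono) auto
  then have i2: "\<alpha> / 16 * L < 2 ^ i" using L8 by (simp add: powr_realpow powr_add)
  have half: "(1 / 2 :: real) ^ m = exp (- (ln 2 * m))" for m
    by (simp add: exp_minus exp_of_nat_mult[symmetric] mult.commute[of "ln 2"] power_one_over inverse_eq_divide exp_of_nat_mult)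
  have ln2: "0 < ln (2 :: real)" "ln (2 :: real) \<le> 1" using ln_le_minus_one[of 2] by auto
  have "ln 2 * real (2 ^ Suc i) \<le> 1 * (\<alpha> / 4 * L)"
    using i1 ln2 by (intro mult_mono) auto
  then have P: "n powr (- (\<alpha> / 4)) \<le> (1 / 2) ^ (2 ^ Suc i)"
    unfolding half expL by simp
  have "\<alpha> / 16 * L * ln 2 \<le> 2 ^ i * ln 2" using i2 ln2 by (intro mult_right_mono) auto
  then have Q: "(1 / 2) ^ (2 ^ i) \<le> n powr (- (\<alpha> * ln 2 / 16))"
    unfolding half expL by (simp add: mult_ac)
  have "n powr (\<alpha> / 2) * real \<tau> \<le> n powr (\<alpha> / 2) * n powr (1 - \<alpha> / 2)"
    using \<tau>_le by (intro mult_left_mono) auto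
  then have "n powr (\<alpha> / 2) * real \<tau> \<le> n" using n by (simp add: powr_add[symmetric])
  then have n\<tau>: "n powr (\<alpha> / 2) \<le> n / \<tau>" using tau by (simp add: field_simps)
  have "real \<tau> \<le> n powr 1" using \<tau>_le n \<alpha> by (intro order_trans[OF \<tau>_le] powr_mono) auto
  then have \<tau>n: "\<tau> \<le> n" using n by simp
  have "((1/16) * (1/2 :: real) ^ (2 ^ i)) powr (1.5 ^ j) * n \<le>
      (n powr (- (\<alpha> * ln 2 / 16))) powr (1.5 ^ j) * n powr 1"
  proof -
    have "(1/16) * (1/2 :: real) ^ (2 ^ i) \<le> 1 * (1/2) ^ (2 ^ i)" by (intro mult_right_mono) auto
    with Q have "(1/16) * (1/2 :: real) ^ (2 ^ i) \<le> n powr (- (\<alpha> * ln 2 / 16))" by linarith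
    then show ?thesis using n by (intro mult_mono powr_mono2) auto
  qed
  \<comment> \<open>The exponent is negative by the choice of \<open>j\<close>, whatever the value
    of n.\<close>
  also have "\<dots> = n powr (1 - \<alpha> / 16 * ln 2 * 1.5 ^ j)"
    unfolding powr_powr powr_add[symmetric] by (simp add: algebra_simps)
  also have "\<dots> < 1" using n j by (simp add: powr_less_one)
  finally have small: "((1/16) * (1/2 :: real) ^ (2 ^ i)) powr (1.5 ^ j) * n < 1" .
  have "n powr (\<alpha> / 4) = n powr (- (\<alpha> / 4)) * n powr (\<alpha> / 2)"
    by (simp add: powr_add[symmetric])
  also have "\<dots> \<le> (1/2) ^ (2 ^ Suc i) * (n / \<tau>)"
    using P n\<tau> by (intro mult_mono) auto
  finally have "2 powr (- (1 / 32) * (1/2) ^ (2 ^ Suc i) * (n / \<tau>)) \<le> 2 powr (- (1 / 32) * real n powr (\<alpha> / 4))"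
    by (intro powr_mono) auto
  moreover have "real i \<le> ln n"
  proof -
    have "real i \<le> 2 ^ i" using of_nat_less_two_power[of i] by (rule less_imp_le)
    also have "\<dots> \<le> \<alpha> / 8 * L" by (rule i1)
    also have "\<dots> \<le> 1 * L" using \<alpha> L by (intro mult_right_mono) auto
    finally show ?thesis by (simp add: L_def)
  qed
  ultimately have e1: "i * 2 powr (- (1 / 32) * (1/2) ^ (2 ^ Suc i) * (n / \<tau>)) \<le> ln n * 2 powr (- (1 / 32) * real n powr (\<alpha> / 4))"
    using n by (intro mult_mono) auto
  have "sqrt ((1/2) ^ (2 ^ i)) \<le> sqrt (n powr (- (\<alpha> * ln 2 / 16)))" using Q by simp
  also have "\<dots> = n powr (- (\<alpha> * ln 2 / 32))"
    by (simp add: powr_half_sqrt[symmetric] powr_powr)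
  finally have e2: "16 * real j * sqrt ((1/2) ^ (2 ^ i)) \<le> 16 * real j * n powr (- (\<alpha> * ln 2 / 32))"
    by (intro mult_left_mono) auto
  interpret prob_space "seed_space k G"
  proof -
    interpret N: prob_space "uniform_count_measure seeds"
      by (rule prob_space_uniform_count_measure[OF finite_seeds seeds_nonempty])
    show "prob_space (seed_space k G)"
      unfolding seed_space_eq by (intro prob_space_PiM N.prob_space_axioms)
  qed
  have cong: "max_load G ord \<tau> tie w = max_load G ord \<tau> tie w'"
    if "\<And>i. i < n \<Longrightarrow> w i = w' i" for w w'
    unfolding max_load_def using ld_cong[of n w w'] that by simp
  have "log 2 (\<alpha> / 8 * L) \<le> log 2 L"
    using L \<alpha> L8 by (intro log_mono) auto
  then have "real (32 + i + j) \<le> log 2 (ln n) + (32 + real j)"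
    using i by (simp add: L_def)
  then have "{w \<in> space (seed_space k G). max_load G ord \<tau> tie w < 32 + i + j} \<subseteq>
      {w \<in> space (seed_space k G). real (max_load G ord \<tau> tie w) < log 2 (ln n) + (32 + real j)}"
    by (force simp del: of_nat_add)
  then have "measure (seed_space k G) {w \<in> space (seed_space k G). max_load G ord \<tau> tie w < 32 + i + j} \<le>
      measure (seed_space k G) {w \<in> space (seed_space k G).
        real (max_load G ord \<tau> tie w) < log 2 (ln n) + (32 + real j)}"
    by (rule finite_measure_mono) (rule sets_seed_event[of n], subst cong, auto)
  with max_load_bound[OF assms(1) \<tau>n small] e1 e2 show ?thesis by linarith
qed

end

text \<open>The growth condition, raised to the power 1 - \<alpha>, gives c at most (\<alpha> e /
  40) x^(1-\<alpha>). Since ln y is at most y / e, taking y = x^(\<alpha>/2) gives ln x at most (2 /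
  (\<alpha> e)) x^(\<alpha>/2). The constants multiply to 1/20.\<close>

lemma mult_ln_le_powr:
  fixes \<alpha> c x :: real
  assumes "0 < \<alpha>" "\<alpha> < 1" "0 < c" "1 < x" "(40 * c / (\<alpha> * exp 1)) powr (1 / (1 - \<alpha>)) \<le> x"
  shows "c * ln x \<le> x powr (1 - \<alpha> / 2)"
proof -
  have "(40 * c / (\<alpha> * exp 1)) = ((40 * c / (\<alpha> * exp 1)) powr (1 / (1 - \<alpha>))) powr (1 - \<alpha>)"
    using assms(1-3) by (simp add: powr_powr)
  also have "\<dots> \<le> x powr (1 - \<alpha>)" using assms by (intro powr_mono2) auto
  finally have c: "c \<le> \<alpha> * exp 1 / 40 * x powr (1 - \<alpha>)"
    using assms(1) by (simp add: field_simps)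
  have "ln (x powr (\<alpha> / 2) / exp 1) \<le> x powr (\<alpha> / 2) / exp 1 - 1"
    using assms(4) by (intro ln_le_minus_one) simp
  then have "\<alpha> / 2 * ln x \<le> x powr (\<alpha> / 2) / exp 1"
    using assms(4) by (simp add: ln_div ln_powr)
  then have l: "ln x \<le> 2 / (\<alpha> * exp 1) * x powr (\<alpha> / 2)"
    using assms(1) by (simp add: field_simps)
  have "c * ln x \<le> (\<alpha> * exp 1 / 40 * x powr (1 - \<alpha>)) * (2 / (\<alpha> * exp 1) * x powr (\<alpha> / 2))"
    using c l assms by (intro mult_mono) auto
  also have "\<dots> = 1 / 20 * (x powr (1 - \<alpha>) * x powr (\<alpha> / 2))"
    using assms(1) by simp
  also have "\<dots> = 1 / 20 * x powr (1 - \<alpha> / 2)"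
    by (simp add: powr_add[symmetric])
  also have "\<dots> \<le> 1 * x powr (1 - \<alpha> / 2)" by (intro mult_right_mono) auto
  finally show ?thesis by simp
qed

theorem theorem2:
  fixes I :: "nat set" and k :: nat and G :: "nat \<Rightarrow> 'v pair_pre_digraph"
    and ord :: "nat \<Rightarrow> 'v \<Rightarrow> 'v rel" and tie :: "nat \<Rightarrow> 'v config list \<Rightarrow> bool"
    and c :: "nat \<Rightarrow> real" and \<alpha> :: real
  assumes "infinite I" and "\<And>n. n \<in> I \<Longrightarrow> n > 0"
    and "k \<ge> 2"
    and "\<And>n. n \<in> I \<Longrightarrow> connected_regular_graph k (G n)"
    and "\<And>n. n \<in> I \<Longrightarrow> card (pverts (G n)) = n"
    and "\<And>n i. n \<in> I \<Longrightarrow> i \<in> pverts (G n) \<Longrightarrow>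
           strict_linear_order_on (neighbours (G n) i) (ord n i)"
    and "\<And>n. n \<in> I \<Longrightarrow> c n > 0"
    and "0 < \<alpha>" and "\<alpha> < 1"
    and "\<forall>\<^sub>F n in inf sequentially (principal I).
           real n \<ge> max (if \<forall>m\<in>I. c m * ln (real m) \<in> \<int> then exp (1 / c n) else exp (10 / c n))
                        ((40 * c n / (\<alpha> * exp 1)) powr (1 / (1 - \<alpha>)))"
    and "\<And>n. n \<in> I \<Longrightarrow>
           measure (seed_space k (G n))
             {\<omega> \<in> space (seed_space k (G n)).
                first_restart (G n) (ord n) (period (c n) n) \<omega> < period (c n) n} \<le> 0.1"
  shows "\<exists>K::real.
           ((\<lambda>n. measure (seed_space k (G n))
               {\<omega> \<in> space (seed_space k (G n)).
                  real (max_load (G n) (ord n) (period (c n) n) (tie n) \<omega>)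
                    < log 2 (ln (real n)) + K}) \<longlongrightarrow> 1)
             (inf sequentially (principal I))"
proof -
  define F where "F = inf sequentially (principal I)"
  obtain j :: nat where j: "1 < \<alpha> / 16 * ln 2 * 1.5 ^ j"
  proof -
    have pos: "0 < \<alpha> / 16 * ln 2" using assms(8) by simp
    obtain j :: nat where "1 / (\<alpha> / 16 * ln 2) < 1.5 ^ j"
      using real_arch_pow[of "1.5" "1 / (\<alpha> / 16 * ln 2)"] by auto
    then have "1 < 1.5 ^ j * (\<alpha> / 16 * ln 2)" using pos by (simp only: pos_divide_less_eq)
    then show thesis by (intro that) (simp only: mult.commute)
  qed
  define err where "err n = ln (real n) * 2 powr (- (1 / 32) * real n powr (\<alpha> / 4))
    + 16 * real j * real n powr (- (\<alpha> * ln 2 / 32))" for n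
  define prob where "prob n = measure (seed_space k (G n)) {\<omega> \<in> space (seed_space k (G n)).
      real (max_load (G n) (ord n) (period (c n) n) (tie n) \<omega>) < log 2 (ln (real n)) + (32 + real j)}" for n
  have err: "(\<lambda>n. 1 - err n) \<longlonglongrightarrow> 1"
  proof -
    have "(\<lambda>n::nat. ln (real n) * 2 powr (- (1 / 32) * real n powr (\<alpha> / 4))) \<longlonglongrightarrow> 0"
      using assms(8) by real_asymp
    moreover have "(\<lambda>n::nat. 16 * real j * real n powr (- (\<alpha> * ln 2 / 32))) \<longlonglongrightarrow> 16 * real j * 0"
      using assms(8) by (intro tendsto_intros) real_asymp
    ultimately have "err \<longlonglongrightarrow> 0 + 16 * real j * 0"
      unfolding err_def by (rule tendsto_add)
    then show ?thesis using tendsto_diff[OF tendsto_const, of err 0 sequentially 1] by simp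
  qed
  have bounds: "1 - err n \<le> prob n \<and> prob n \<le> 1"
    if n: "n \<in> I" "real n \<ge> max (if \<forall>m\<in>I. c m * ln (real m) \<in> \<int> then exp (1 / c n) else exp (10 / c n))
                        ((40 * c n / (\<alpha> * exp 1)) powr (1 / (1 - \<alpha>)))"
      "8 \<le> \<alpha> * ln (real n)" for n
  proof -
    have c: "0 < c n" using assms(7) n(1) .
    \<comment> \<open>This holds in both cases of the \<open>if\<close> and gives
      \<open>c n * ln n\<close> at least 1, so that the period is positive.\<close>
    have exp: "exp (1 / c n) \<le> real n"
      by (rule order_trans[OF _ order_trans[OF max.cobounded1 n(2)]])
        (use c in \<open>simp add: divide_right_mono\<close>)
    have n1: "1 < real n"
    proof -
      have "1 < exp (1 / c n)" using c by simp
      with exp show ?thesis by linarith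
    qed
    have "1 / c n \<le> ln (real n)" using exp n1 by (simp add: ln_ge_iff)
    then have "1 \<le> c n * ln (real n)" using c by (simp add: field_simps)
    then have \<tau>: "1 \<le> period (c n) n" "real (period (c n) n) \<le> c n * ln (real n)"
      unfolding period_def by linarith+
    interpret scheme k "G n" "ord n" "period (c n) n" "tie n"
    proof
      show "pverts (G n) \<noteq> {}" using assms(2,5)[OF n(1)] by auto
    qed (use assms n \<tau> in auto)
    have card: "card (pverts (G n)) = n" using assms(5) n(1) .
    have "c n * ln (real n) \<le> real n powr (1 - \<alpha> / 2)"
      using assms(8,9) c n1 n(2) by (intro mult_ln_le_powr) auto
    then have "real (period (c n) n) \<le> real n powr (1 - \<alpha> / 2)" using \<tau>(2) by linarith
    then have "1 - err n \<le> prob n"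
      using max_load_tail[of \<alpha> j] long_epochsI assms(8,9,11) n j unfolding err_def prob_def card by blast
    moreover have "prob n \<le> 1"
    proof -
      have "prob_space (seed_space k (G n))"
        unfolding seed_space_eq
        by (intro prob_space_PiM prob_space_uniform_count_measure finite_seeds seeds_nonempty)
      then show ?thesis unfolding prob_def by (rule prob_space.prob_le_1)
    qed
    ultimately show ?thesis by blast
  qed
  have "\<forall>\<^sub>F n in sequentially. 8 \<le> \<alpha> * ln (real n)"
    using assms(8) by real_asymp
  then have large: "\<forall>\<^sub>F n in F. 8 \<le> \<alpha> * ln (real n)"
    unfolding F_def by (rule filter_leD[OF inf_le1])
  have inI: "\<forall>\<^sub>F n in F. n \<in> I"
    unfolding F_def by (rule filter_leD[OF inf_le2]) (simp add: eventually_principal)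
  have ev: "\<forall>\<^sub>F n in F. 1 - err n \<le> prob n \<and> prob n \<le> 1"
    using assms(10)[folded F_def] large inI by eventually_elim (rule bounds)
  have "(prob \<longlongrightarrow> 1) F"
  proof (rule tendsto_sandwich)
    show "\<forall>\<^sub>F n in F. 1 - err n \<le> prob n" "\<forall>\<^sub>F n in F. prob n \<le> 1"
      using ev by (auto elim: eventually_mono)
    show "((\<lambda>n. 1 - err n) \<longlongrightarrow> 1) F" unfolding F_def by (rule tendsto_mono[OF inf_le1 err])
  qed simp
  then show ?thesis unfolding prob_def F_def by blast
qed

end
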